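(* In the continuous-time scaled model described in the context, assume $x_0=y_0>0$, $x^N_0+y^N_0=T$ for all $N$ (so $T=2x_0$), and $z^N_0=N^{1/2}(x^N_0-y^N_0)\to z_0\in\mathbb R$. Then the scaled residual time $S_N=N^{1/4}(T-\tau_N)$ converges in distribution as $N\to\infty$ to a random variable $S$ with $P(S>0)=1$, whose law is uniquely determined by $$E[S^q]=\Big(\frac23\Big)^{q/4}\frac{\Gamma(\frac12+\frac q4)}{\Gamma(\frac12)}\,T^{3q/4}\,h_{3q/4}\Big(\frac{z_0^2}{2T}\Big),\qquad q>0,$$ where $h_\rho(x)=M\big(-\tfrac{\rho}{3},\tfrac12,-3x\big)$.
   Context: Continuous-time model: $(X_t,Y_t)_{t\ge0}$ is a pure-jump Markov process with nonnegative integer values. Jumps occur at the times of a rate-one Poisson process $(\mathcal N_t)$. At a jump time $t'$, with $q=X_{t'-}/(X_{t'-}+Y_{t'-})$: with probability $q$, $Y$ decreases by $1$; with probability $1-q$, $X$ decreases by $1$. The process is stopped when one coordinate reaches $0$. Scaling: $x^N_t=N^{-1}X_{Nt}$, $y^N_t=N^{-1}Y_{Nt}$, with $x^N_0\to x_0$, $y^N_0\to y_0$; $T=x_0+y_0$; the scaled ruin time is $\tau_N=\inf\{t>0: x^N_t\wedge y^N_t=0\}$. $M(a,b,z)=\sum_{n\ge0}\frac{a^{(n)}}{b^{(n)}n!}z^n$ is Kummer's confluent hypergeometric function, with rising factorial $a^{(0)}=1$, $a^{(n)}=\prod_{j=0}^{n-1}(a+j)$. *)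

theory Defs
  imports "HOL-Probability.Probability"
begin

definition kummerM :: "real \<Rightarrow> real \<Rightarrow> real \<Rightarrow> real" where
  "kummerM a b z = (\<Sum>n. pochhammer a n / (pochhammer b n * fact n) * z ^ n)"

definition hfun :: "real \<Rightarrow> real \<Rightarrow> real" where
  "hfun \<rho> x = kummerM (- \<rho> / 3) (1/2) (- 3 * x)"

text \<open>One jump of the embedded chain, driven by a uniform variable u in [0,1]:
  with q = x/(x+y), if u < q (probability q) Y decreases by 1, otherwise X decreases by 1.
  The chain is stopped (frozen) once a coordinate is 0.\<close>
definition jump_step :: "nat \<times> nat \<Rightarrow> real \<Rightarrow> nat \<times> nat" where
  "jump_step s u = (let (x, y) = s in
     if x = 0 \<or> y = 0 then (x, y)
     else if u < real x / (real x + real y) then (x, y - 1) else (x - 1, y))"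

fun chain :: "nat \<times> nat \<Rightarrow> (nat \<Rightarrow> real) \<Rightarrow> nat \<Rightarrow> nat \<times> nat" where
  "chain s U 0 = s"
| "chain s U (Suc k) = jump_step (chain s U k) (U k)"

text \<open>Rate-one Poisson counting process built from the inter-arrival times E 0, E 1, ...:
  the k-th jump (k >= 1) occurs at time E 0 + ... + E (k-1).\<close>
definition poisson_count :: "(nat \<Rightarrow> real) \<Rightarrow> real \<Rightarrow> nat" where
  "poisson_count E t = card {k. 0 < k \<and> (\<Sum>i<k. E i) \<le> t}"

definition proc :: "nat \<times> nat \<Rightarrow> (nat \<Rightarrow> real) \<Rightarrow> (nat \<Rightarrow> real) \<Rightarrow> real \<Rightarrow> nat \<times> nat" where
  "proc s E U t = chain s U (poisson_count E t)"

definition ruin_time :: "nat \<Rightarrow> nat \<times> nat \<Rightarrow> (nat \<Rightarrow> real) \<Rightarrow> (nat \<Rightarrow> real) \<Rightarrow> real" where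
  "ruin_time N s E U =
     Inf {t. 0 < t \<and> min (real (fst (proc s E U (real N * t))) / real N)
                          (real (snd (proc s E U (real N * t))) / real N) = 0}"

end

theory Submission
  imports Defs "HOL-Real_Asymp.Real_Asymp"
begin

text \<open>Along the embedded chain, \<open>W = (x + y + 1) (x - y)\<close> is a martingale: with \<open>m = x + y\<close> its increments
  are \<open>2y\<close> with probability \<open>x / m\<close> and \<open>- 2x\<close> with probability \<open>y / m\<close>, so the conditional variance is
  \<open>4xy\<close>. At ruin \<open>\<bar>W\<bar> = R (R + 1)\<close>, where \<open>R\<close> is the number of survivors, and absorption freezes \<open>W\<close>;
  hence \<open>R\<close> can be read off \<open>W\<close> after \<open>n = X\<^sub>0 + Y\<^sub>0\<close> steps. Comparing \<open>4xy\<close> with \<open>(n - k)\<^sup>2\<close>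
  step by step gives \<open>W / N powr (3/2) \<longrightarrow> Normal (T z\<^sub>0, T\<^sup>3/3)\<close> in distribution, so the scaled number of survivors
  converges to \<open>S = \<surd>\<bar>Normal (T z\<^sub>0, T\<^sup>3/3)\<bar>\<close>. The Poisson clock only adds an error of order \<open>N powr (- 1/4)\<close>
  on the scale of \<open>S\<close>. The moments of \<open>S\<close> come from expanding the shifted Gaussian density in a \<open>cosh\<close> series and from
  Kummer's transformation; they determine the law because \<open>S\<^sup>2\<close> has exponential moments.\<close>

subsection \<open>The embedded chain\<close>

text \<open>The obstacle is that the conditional variance 4xy is random and drops to 0 at ruin, at a
  random step. Both troubles are met by one inequality: with m = n - k, the defect d = m^2 - 4xy
  satisfies 0 <= d <= m^2 and d m^2 <= W^2, whether or not the chain is already absorbed. Since E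
  W^2 = O(N^3), the mean defect is O(N^(3/2)) per step, negligible against m^2, which is typically
  of order N^2. So the variance of W may be treated as deterministic, no stopping time has to be
  analysed, and the characteristic function obeys an approximate one-step recursion with factor
  exp(-\<theta>^2 m^2 / 2). The parameters of the limit can be read off: m^2 summed over m = 1, ...,
  n is about n^3/3, and the initial value (n + 1)(X_0 - Y_0) is about T N times z_0 N^(1/2). As W
  lives on the scale N^(3/2), the survivors live on the scale N^(3/4); ruin comes after n - R jumps,
  so T minus the ruin time is about R/N, whence the factor N^(1/4).\<close>

abbreviation absorbed :: "nat \<times> nat \<Rightarrow> bool" where
  "absorbed s \<equiv> fst s = 0 \<or> snd s = 0"

text \<open>One step moves x - y by +1 or -1 with mean (x - y)/m, so its conditional mean is
  multiplied by (m + 1)/m. The weight m + 1 = x + y + 1, which becomes m after the step, compensates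
  this factor exactly.\<close>

definition gap :: "nat \<times> nat \<Rightarrow> real" where
  "gap s = (real (fst s) + real (snd s) + 1) * (real (fst s) - real (snd s))"

text \<open>The transition operator of the embedded chain, vector-valued so that it serves both the
  real second moment and the complex characteristic function.\<close>

definition step_mean :: "(nat \<times> nat \<Rightarrow> 'b::real_vector) \<Rightarrow> nat \<times> nat \<Rightarrow> 'b" where
  "step_mean f s = (if absorbed s then f s else
     (real (fst s) / (real (fst s) + real (snd s))) *\<^sub>R f (fst s, snd s - 1) +
     (real (snd s) / (real (fst s) + real (snd s))) *\<^sub>R f (fst s - 1, snd s))"

lemma jump_step_eq:
  "jump_step s u = (if absorbed s then s
     else if u < real (fst s) / (real (fst s) + real (snd s)) then (fst s, snd s - 1)
     else (fst s - 1, snd s))"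
  by (cases s) (auto simp: jump_step_def Let_def)

lemma measurable_jump_step [measurable]: "jump_step s \<in> borel \<rightarrow>\<^sub>M count_space UNIV"
  unfolding jump_step_eq[abs_def] by measurable

text \<open>Only the first k drivers enter the hypothesis, so the lemma also applies to coordinate
  functions on a product over just these indices.\<close>

lemma measurable_chain:
  assumes "\<And>i. i < k \<Longrightarrow> V i \<in> borel_measurable N"
  shows "(\<lambda>\<omega>. chain s (\<lambda>i. V i \<omega>) k) \<in> N \<rightarrow>\<^sub>M count_space UNIV"
  using assms
proof (induction k)
  case (Suc k)
  have [measurable]: "V k \<in> borel_measurable N"
    using Suc.prems by simp
  have [measurable]: "(\<lambda>\<omega>. chain s (\<lambda>i. V i \<omega>) k) \<in> N \<rightarrow>\<^sub>M count_space UNIV"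
    using Suc by simp
  show ?case
    unfolding chain.simps
    by (rule measurable_compose_countable[where g="\<lambda>\<omega>. chain s (\<lambda>i. V i \<omega>) k"]) measurable
qed simp

lemma chain_cong: "(\<And>i. i < k \<Longrightarrow> u i = v i) \<Longrightarrow> chain s u k = chain s v k"
  by (induction k) auto

lemma chain_bounds: "fst (chain s u k) \<le> fst s \<and> snd (chain s u k) \<le> snd s"
  by (induction k) (auto simp: jump_step_eq)

lemma chain_in_range: "chain s u k \<in> {..fst s} \<times> {..snd s}"
  using chain_bounds[of s u k] by (cases "chain s u k") auto

lemma chain_total:
  assumes "\<not> absorbed (chain s u k)"
  shows "fst (chain s u k) + snd (chain s u k) + k = fst s + snd s"
  using assms by (induction k) (auto simp: jump_step_eq split: if_splits)

lemma chain_total_ge: "fst s + snd s \<le> fst (chain s u k) + snd (chain s u k) + k"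
  by (induction k) (auto simp: jump_step_eq)

lemma chain_absorbed: "absorbed (chain s u k) \<Longrightarrow> k \<le> l \<Longrightarrow> chain s u l = chain s u k"
  by (induction l) (auto simp: jump_step_eq le_Suc_eq)

lemma chain_absorbed_at_total: "absorbed (chain s u (fst s + snd s))"
  using chain_total[of s u "fst s + snd s"] by fastforce

lemma chain_antimono:
  "k \<le> l \<Longrightarrow> fst (chain s u l) + snd (chain s u l) \<le> fst (chain s u k) + snd (chain s u k)"
  by (induction rule: dec_induct) (auto simp: jump_step_eq)

text \<open>The chain is evaluated at a deterministic step by which absorption is certain; the
  survivors are thus a function of finitely many drivers, without a stopping time.\<close>

definition survivors :: "nat \<times> nat \<Rightarrow> (nat \<Rightarrow> real) \<Rightarrow> nat" where
  "survivors s u = fst (chain s u (fst s + snd s)) + snd (chain s u (fst s + snd s))"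

lemma survivors_le: "survivors s u \<le> fst s + snd s"
  using chain_bounds[of s u "fst s + snd s"] by (auto simp: survivors_def)

text \<open>Until absorption every step removes exactly one individual, and absorption freezes the
  total at \<open>survivors\<close>; hence the first absorbed step is the initial total minus
  \<open>survivors\<close>.\<close>

lemma absorbed_chain_iff: "absorbed (chain s u k) \<longleftrightarrow> fst s + snd s - survivors s u \<le> k"
proof
  assume a: "absorbed (chain s u k)"
  show "fst s + snd s - survivors s u \<le> k"
  proof (cases "k \<le> fst s + snd s")
    case True
    then show ?thesis
      using chain_absorbed[OF a True] chain_total_ge[of s u k] by (simp add: survivors_def)
  qed simp
next
  assume k: "fst s + snd s - survivors s u \<le> k"
  show "absorbed (chain s u k)"
  proof (rule ccontr)
    assume n: "\<not> absorbed (chain s u k)"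
    have "Suc k \<le> fst s + snd s"
      using chain_total[OF n] n by auto
    then have "survivors s u \<le> fst (chain s u (Suc k)) + snd (chain s u (Suc k))"
      unfolding survivors_def by (rule chain_antimono)
    also have "\<dots> < fst (chain s u k) + snd (chain s u k)"
      using n by (auto simp: jump_step_eq)
    finally show False
      using k chain_total[OF n] by linarith
  qed
qed

lemma abs_gap_final:
  "\<bar>gap (chain s u (fst s + snd s))\<bar> = real (survivors s u) * (real (survivors s u) + 1)"
  using chain_absorbed_at_total[of s u] by (auto simp: gap_def survivors_def abs_mult)

text \<open>The conditional variance of the next increment of \<^const>\<open>gap\<close> is \<open>4xy\<close>. It falls short of
  \<open>m\<^sup>2\<close>, where \<open>m\<close> is the total the chain would have without absorption, by an amount that
  is controlled by \<^const>\<open>gap\<close> itself, before and after absorption.\<close>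

lemma chain_variance_defect:
  fixes s u k
  defines "d \<equiv> (real (fst s + snd s) - real k)\<^sup>2
                  - 4 * real (fst (chain s u k)) * real (snd (chain s u k))"
  assumes k: "k \<le> fst s + snd s"
  shows "0 \<le> d" "d \<le> (real (fst s + snd s) - real k)\<^sup>2"
    and "d * (real (fst s + snd s) - real k)\<^sup>2 \<le> (gap (chain s u k))\<^sup>2"
proof -
  define x y where "x = real (fst (chain s u k))" and "y = real (snd (chain s u k))"
  define m where "m = real (fst s + snd s) - real k"
  have nn: "0 \<le> x" "0 \<le> y" "0 \<le> m"
    using k by (auto simp: x_def y_def m_def)
  have d: "d = m\<^sup>2 - 4 * x * y"
    by (simp add: d_def m_def x_def y_def)
  have "real (fst s + snd s) \<le> real (fst (chain s u k) + snd (chain s u k) + k)"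
    using chain_total_ge[of s u k] by (simp only: of_nat_le_iff)
  then have le: "m \<le> x + y"
    by (simp add: m_def x_def y_def)
  have gap: "gap (chain s u k) = (x + y + 1) * (x - y)"
    by (simp add: gap_def x_def y_def)
  show "d \<le> (real (fst s + snd s) - real k)\<^sup>2"
    unfolding d m_def[symmetric] using nn by simp
  have "0 \<le> d \<and> d * m\<^sup>2 \<le> (gap (chain s u k))\<^sup>2"
  proof (cases "absorbed (chain s u k)")
    case True
    then have xy: "x * y = 0"
      by (auto simp: x_def y_def)
    have "d * m\<^sup>2 = m\<^sup>2 * m\<^sup>2"
      unfolding d mult.assoc xy by simp
    also have "\<dots> \<le> (x + y + 1)\<^sup>2 * (x + y)\<^sup>2"
      using nn le by (intro mult_mono power_mono) auto
    also have "\<dots> = (gap (chain s u k))\<^sup>2"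
      using xy by (auto simp: gap power_mult_distrib power2_commute)
    finally show ?thesis
      using xy by (auto simp: d)
  next
    case False
    have "real (fst (chain s u k) + snd (chain s u k) + k) = real (fst s + snd s)"
      using chain_total[OF False] by (simp only: of_nat_eq_iff)
    then have m: "m = x + y"
      by (simp add: m_def x_def y_def)
    \<comment> \<open>Before absorption m = x + y, and (x + y)^2 - 4xy is a perfect square.\<close>
    have d': "d = (x - y)\<^sup>2"
      by (simp add: d m power2_eq_square algebra_simps)
    have "d * m\<^sup>2 \<le> (x - y)\<^sup>2 * (x + y + 1)\<^sup>2"
      unfolding d' m using nn by (intro mult_left_mono power_mono) auto
    then show ?thesis
      by (simp add: d' gap power_mult_distrib mult.commute)
  qed
  then show "0 \<le> d" "d * (real (fst s + snd s) - real k)\<^sup>2 \<le> (gap (chain s u k))\<^sup>2"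
    by (simp_all add: m_def)
qed

section \<open>One-step moments and characteristic function of the martingale\<close>

lemma gap_steps:
  assumes "x > 0" "y > 0"
  shows "gap (x, y - Suc 0) = gap (x, y) + 2 * real y" "gap (x - Suc 0, y) = gap (x, y) - 2 * real x"
  using assms by (simp_all add: gap_def of_nat_diff algebra_simps)

text \<open>With p = x/(x + y) and q = y/(x + y), the balance p y = q x removes the term linear in
  the increment and turns 4 (p y^2 + q x^2) into 4xy. For an absorbed state xy = 0.\<close>

lemma step_mean_gap_sq:
  "step_mean (\<lambda>s. (gap s)\<^sup>2) s = (gap s)\<^sup>2 + 4 * real (fst s) * real (snd s)"
proof (cases "absorbed s")
  case False
  define x y where "x = fst s" and "y = snd s"
  have s: "s = (x, y)" and xy: "x > 0" "y > 0"
    using False by (auto simp: x_def y_def)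
  define p q where "p = real x / (real x + real y)" and "q = real y / (real x + real y)"
  have pq: "p + q = 1" "p * real y = q * real x"
    using xy by (auto simp: p_def q_def simp flip: add_divide_distrib)
  have "step_mean (\<lambda>s. (gap s)\<^sup>2) s = p * (gap (x, y) + 2 * real y)\<^sup>2 + q * (gap (x, y) - 2 * real x)\<^sup>2"
    using xy by (simp add: step_mean_def s gap_steps p_def q_def)
  also have "\<dots> = (p + q) * (gap (x, y))\<^sup>2 + 4 * gap (x, y) * (p * real y - q * real x)
      + 4 * (p * real y) * real y + 4 * (q * real x) * real x"
    by (simp add: power2_eq_square algebra_simps)
  also have "\<dots> = (gap (x, y))\<^sup>2 + 4 * (q * real x) * real y + 4 * (p * real y) * real x"
    by (simp add: pq)
  also have "\<dots> = (gap (x, y))\<^sup>2 + 4 * (p + q) * real x * real y"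
    by (simp add: algebra_simps)
  finally show ?thesis
    by (simp add: pq s)
qed (auto simp: step_mean_def)

text \<open>Second-order Taylor expansion at the two increments: the linear terms cancel by p y = q
  x, the quadratic ones give 4xy, and increments of size at most 2(x + y) leave a remainder of (8/6)
  |\<theta>|^3 (x + y)^3, rounded up to the factor 2.\<close>

lemma step_mean_iexp_gap:
  "cmod (step_mean (\<lambda>s. iexp (\<theta> * gap s)) s
      - iexp (\<theta> * gap s) * complex_of_real (1 - \<theta>\<^sup>2 / 2 * (4 * real (fst s) * real (snd s))))
    \<le> 2 * \<bar>\<theta>\<bar> ^ 3 * (real (fst s + snd s)) ^ 3"
proof (cases "absorbed s")
  case False
  define x y where "x = real (fst s)" and "y = real (snd s)"
  have xy: "fst s > 0" "snd s > 0" "x > 0" "y > 0"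
    using False by (auto simp: x_def y_def)
  define p q where "p = x / (x + y)" and "q = y / (x + y)"
  have pq: "p + q = 1" "p * y = q * x" "0 \<le> p" "0 \<le> q"
    using xy by (auto simp: p_def q_def simp flip: add_divide_distrib)
  define r where "r a = iexp a - complex_of_real (1 - a\<^sup>2 / 2) - \<i> * complex_of_real a" for a :: real
  have r: "cmod (r a) \<le> \<bar>a\<bar> ^ 3 / 6" for a
    using iexp_approx1[of a 2]
    by (simp add: r_def eval_nat_numeral fact_reduce algebra_simps)
  have g: "gap (fst s, snd s - Suc 0) = gap s + 2 * y" "gap (fst s - Suc 0, snd s) = gap s - 2 * x"
    using gap_steps[OF xy(1,2)] by (simp_all add: x_def y_def)
  let ?F = "iexp (\<theta> * gap s)"
  have "step_mean (\<lambda>s. iexp (\<theta> * gap s)) s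
      = of_real p * iexp (\<theta> * (gap s + 2 * y)) + of_real q * iexp (\<theta> * (gap s - 2 * x))"
    using xy by (simp add: step_mean_def g p_def q_def scaleR_conv_of_real flip: x_def y_def)
  also have "\<dots> = ?F * (of_real p * iexp (\<theta> * (2 * y)) + of_real q * iexp (\<theta> * (- 2 * x)))"
    by (simp add: algebra_simps exp_diff exp_add exp_minus divide_simps)
  also have "of_real p * iexp (\<theta> * (2 * y)) + of_real q * iexp (\<theta> * (- 2 * x)) =
      of_real p * r (\<theta> * (2 * y)) + of_real q * r (\<theta> * (- 2 * x))
      + of_real (p + q - \<theta>\<^sup>2 / 2 * (4 * ((p * y) * y + (q * x) * x))) + \<i> * of_real (2 * \<theta> * (p * y - q * x))"
    by (simp add: r_def algebra_simps power2_eq_square)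
  also have "(p * y) * y + (q * x) * x = (p + q) * x * y"
    by (subst pq(2), subst pq(2)[symmetric]) (simp add: algebra_simps)
  finally have eq: "step_mean (\<lambda>s. iexp (\<theta> * gap s)) s - ?F * complex_of_real (1 - \<theta>\<^sup>2 / 2 * (4 * x * y))
      = ?F * (of_real p * r (\<theta> * (2 * y)) + of_real q * r (\<theta> * (- 2 * x)))"
    by (simp add: pq algebra_simps)
  have b: "cmod (r (\<theta> * a)) \<le> (\<bar>\<theta>\<bar> * (2 * (x + y))) ^ 3 / 6" if "\<bar>a\<bar> \<le> 2 * (x + y)" for a
    using that by (intro order_trans[OF r] divide_right_mono power_mono) (auto simp: abs_mult mult_left_mono)
  have "cmod (?F * (of_real p * r (\<theta> * (2 * y)) + of_real q * r (\<theta> * (- 2 * x))))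
      = cmod (of_real p * r (\<theta> * (2 * y)) + of_real q * r (\<theta> * (- 2 * x)))"
    by (simp add: norm_mult)
  also have "\<dots> \<le> p * cmod (r (\<theta> * (2 * y))) + q * cmod (r (\<theta> * (- 2 * x)))"
    using pq by (intro order_trans[OF norm_triangle_ineq]) (simp add: norm_mult)
  also have "\<dots> \<le> p * ((\<bar>\<theta>\<bar> * (2 * (x + y))) ^ 3 / 6) + q * ((\<bar>\<theta>\<bar> * (2 * (x + y))) ^ 3 / 6)"
    using xy pq by (intro add_mono mult_left_mono b) auto
  also have "\<dots> = (p + q) * ((\<bar>\<theta>\<bar> * (2 * (x + y))) ^ 3 / 6)"
    by (simp add: algebra_simps)
  also have "\<dots> = 8 / 6 * \<bar>\<theta>\<bar> ^ 3 * (x + y) ^ 3"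
    using power_mult_distrib[of 2 "x + y" 3] by (simp only: pq power_mult_distrib) simp
  also have "\<dots> \<le> 2 * \<bar>\<theta>\<bar> ^ 3 * (x + y) ^ 3"
    using xy by (intro mult_right_mono) auto
  finally show ?thesis
    unfolding eq[symmetric] by (simp add: x_def y_def mult.assoc)
qed (auto simp: step_mean_def)

section \<open>Markov property and second moments of the driven chain\<close>

locale driven_chain = prob_space M for M :: "'a measure" +
  fixes E U :: "nat \<Rightarrow> 'a \<Rightarrow> real"
  assumes indep: "indep_vars (\<lambda>_. borel) (\<lambda>i. case i of Inl k \<Rightarrow> E k | Inr k \<Rightarrow> U k) UNIV"
    and E_distributed: "distributed M lborel (E k) (\<lambda>x. ennreal (exponential_density 1 x))"
    and U_distributed: "distributed M lborel (U k) (\<lambda>x. ennreal (indicator {0..1} x))"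
begin

lemma measurable_E [measurable]: "random_variable borel (E k)"
  using distributed_measurable[OF E_distributed[of k]] by simp

lemma measurable_U [measurable]: "random_variable borel (U k)"
  using distributed_measurable[OF U_distributed[of k]] by simp

abbreviation state :: "nat \<times> nat \<Rightarrow> nat \<Rightarrow> 'a \<Rightarrow> nat \<times> nat" where
  "state s k \<omega> \<equiv> chain s (\<lambda>i. U i \<omega>) k"

lemma measurable_state [measurable]: "state s k \<in> M \<rightarrow>\<^sub>M count_space UNIV"
  by (rule measurable_chain) simp

text \<open>The chain stays in a finite box, so any function of it is bounded.\<close>

lemma integrable_state [simp]:
  fixes f :: "nat \<times> nat \<Rightarrow> 'b::{banach, second_countable_topology}"
  shows "integrable M (\<lambda>\<omega>. f (state s k \<omega>))"
proof (rule integrable_const_bound)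
  have "norm (f (state s k \<omega>)) \<le> (MAX p\<in>{..fst s} \<times> {..snd s}. norm (f p))" for \<omega>
    using chain_in_range[of s "\<lambda>i. U i \<omega>" k] by (intro Max_ge) auto
  then show "AE \<omega> in M. norm (f (state s k \<omega>)) \<le> (MAX p\<in>{..fst s} \<times> {..snd s}. norm (f p))"
    by simp
qed simp

lemma integral_jump_step:
  fixes f :: "nat \<times> nat \<Rightarrow> 'b::{banach, second_countable_topology}"
  shows "(\<integral>u. f (jump_step p u) \<partial>distr M borel (U k)) = step_mean f p"
proof -
  have [measurable]: "f \<in> borel_measurable (count_space UNIV)"
    by simp
  have U: "distr M borel (U k) = density lborel (\<lambda>x. ennreal (indicator {0..1} x))"
    using distributed_distr_eq_density[OF U_distributed[of k]]
    by (simp add: distr_cong[where N=borel and L=lborel, OF refl, OF sym])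
  have eq: "(\<integral>u. f (jump_step p u) \<partial>distr M borel (U k)) = (\<integral>u. indicator {0..1} u *\<^sub>R f (jump_step p u) \<partial>lborel)"
    unfolding U by (subst integral_density) (auto intro!: Bochner_Integration.integral_cong)
  show ?thesis
  proof (cases "absorbed p")
    case True
    then show ?thesis
      unfolding eq by (simp add: jump_step_eq step_mean_def)
  next
    case False
    define q where "q = real (fst p) / (real (fst p) + real (snd p))"
    have q: "0 \<le> q" "q \<le> 1" and q': "1 - q = real (snd p) / (real (fst p) + real (snd p))"
      using False by (auto simp: q_def field_simps)
    have "(\<integral>u. indicator {0..1} u *\<^sub>R f (jump_step p u) \<partial>lborel)
      = (\<integral>u. indicator {0..<q} u *\<^sub>R f (fst p, snd p - 1) + indicator {q..1} u *\<^sub>R f (fst p - 1, snd p) \<partial>lborel)"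
      using False q by (intro Bochner_Integration.integral_cong)
        (auto simp: jump_step_eq indicator_def simp flip: q_def)
    also have "\<dots> = q *\<^sub>R f (fst p, snd p - 1) + (1 - q) *\<^sub>R f (fst p - 1, snd p)"
      using q by simp
    finally show ?thesis
      using False unfolding eq q' by (simp add: step_mean_def q_def)
  qed
qed

text \<open>The Markov property in integrated form. The state after k steps uses the coordinates
  \<open>Inr i\<close> with i < k, the next jump only \<open>Inr k\<close>; their joint law is a
  product, so Fubini integrates the new uniform variable out first.\<close>

lemma expectation_step:
  fixes f :: "nat \<times> nat \<Rightarrow> 'b::{banach, second_countable_topology}"
  shows "(\<integral>\<omega>. f (state s (Suc k) \<omega>) \<partial>M) = (\<integral>\<omega>. step_mean f (state s k \<omega>) \<partial>M)"
proof -
  let ?X = "\<lambda>i. case i of Inl k \<Rightarrow> E k | Inr k \<Rightarrow> U k"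
  define A B :: "(nat + nat) set" where "A = Inr ` {..<k}" and "B = {Inr k}"
  define P Q :: "(nat + nat \<Rightarrow> real) measure" where "P = PiM A (\<lambda>_. borel)" and "Q = PiM B (\<lambda>_. borel)"
  define past now where "past \<omega> = restrict (\<lambda>i. ?X i \<omega>) A" and "now \<omega> = restrict (\<lambda>i. ?X i \<omega>) B" for \<omega>
  define c where "c x = chain s (\<lambda>i. x (Inr i)) k" for x :: "nat + nat \<Rightarrow> real"
  have ind: "indep_var P past Q now"
    unfolding P_def Q_def past_def[abs_def] now_def[abs_def]
    by (rule indep_var_restrict[OF indep]) (auto simp: A_def B_def)
  then have [measurable]: "past \<in> M \<rightarrow>\<^sub>M P" "now \<in> M \<rightarrow>\<^sub>M Q"
    by (auto dest: indep_var_rv1 indep_var_rv2)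
  have [measurable]: "c \<in> P \<rightarrow>\<^sub>M count_space UNIV"
    unfolding c_def[abs_def] P_def by (rule measurable_chain) (auto simp: A_def)
  have [measurable]: "(\<lambda>y. y (Inr k)) \<in> borel_measurable Q"
    by (simp add: Q_def B_def)
  have c: "c (past \<omega>) = state s k \<omega>" and u: "now \<omega> (Inr k) = U k \<omega>" for \<omega>
    by (auto simp: c_def past_def now_def A_def B_def intro!: chain_cong)
  interpret P: prob_space "distr M P past" by (rule prob_space_distr) simp
  interpret Q: prob_space "distr M Q now" by (rule prob_space_distr) simp
  interpret PQ: pair_sigma_finite "distr M P past" "distr M Q now" ..
  have joint: "distr M P past \<Otimes>\<^sub>M distr M Q now = distr M (P \<Otimes>\<^sub>M Q) (\<lambda>\<omega>. (past \<omega>, now \<omega>))"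
    using ind unfolding indep_var_distribution_eq by simp
  have [measurable]: "f \<in> borel_measurable (count_space UNIV)"
    by simp
  have meas [measurable]: "(\<lambda>z. f (jump_step (c (fst z)) (snd z (Inr k)))) \<in> borel_measurable (P \<Otimes>\<^sub>M Q)"
    by (rule measurable_compose_countable[where g="\<lambda>z. c (fst z)"]) measurable
  have "(\<integral>\<omega>. f (state s (Suc k) \<omega>) \<partial>M)
      = (\<integral>z. f (jump_step (c (fst z)) (snd z (Inr k))) \<partial>(distr M P past \<Otimes>\<^sub>M distr M Q now))"
    unfolding joint by (subst integral_distr) (auto simp: c u)
  also have "\<dots> = (\<integral>x. (\<integral>y. f (jump_step (c x) (y (Inr k))) \<partial>distr M Q now) \<partial>distr M P past)"
  proof (rule PQ.integral_fst'[symmetric, where f="\<lambda>z. f (jump_step (c (fst z)) (snd z (Inr k)))", simplified])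
    have "integrable M (\<lambda>\<omega>. f (state s (Suc k) \<omega>))"
      by (rule integrable_state)
    then show "integrable (distr M P past \<Otimes>\<^sub>M distr M Q now) (\<lambda>z. f (jump_step (c (fst z)) (snd z (Inr k))))"
      unfolding joint by (subst integrable_distr_eq) (auto simp: c u)
  qed
  also have "\<dots> = (\<integral>x. step_mean f (c x) \<partial>distr M P past)"
  proof (intro Bochner_Integration.integral_cong refl)
    fix x
    have "(\<integral>y. f (jump_step (c x) (y (Inr k))) \<partial>distr M Q now) = (\<integral>\<omega>. f (jump_step (c x) (U k \<omega>)) \<partial>M)"
      by (subst integral_distr) (auto simp: u)
    also have "\<dots> = (\<integral>u. f (jump_step (c x) u) \<partial>distr M borel (U k))"
      by (subst integral_distr) auto
    finally show "(\<integral>y. f (jump_step (c x) (y (Inr k))) \<partial>distr M Q now) = step_mean f (c x)"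
      by (simp only: integral_jump_step)
  qed
  also have "\<dots> = (\<integral>\<omega>. step_mean f (state s k \<omega>) \<partial>M)"
    by (subst integral_distr) (auto simp: c)
  finally show ?thesis .
qed

text \<open>Martingale increments are orthogonal, so each step adds only the mean of 4xy, which is
  at most n^2.\<close>

lemma second_moment_gap:
  assumes "k \<le> fst s + snd s"
  shows "(\<integral>\<omega>. (gap (state s k \<omega>))\<^sup>2 \<partial>M) \<le> (gap s)\<^sup>2 + real k * (real (fst s + snd s))\<^sup>2"
  using assms
proof (induction k)
  case (Suc k)
  have "(\<integral>\<omega>. (gap (state s (Suc k) \<omega>))\<^sup>2 \<partial>M)
      = (\<integral>\<omega>. (gap (state s k \<omega>))\<^sup>2 + 4 * real (fst (state s k \<omega>)) * real (snd (state s k \<omega>)) \<partial>M)"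
    by (subst expectation_step) (simp only: step_mean_gap_sq)
  also have "\<dots> \<le> (\<integral>\<omega>. (gap (state s k \<omega>))\<^sup>2 + (real (fst s + snd s))\<^sup>2 \<partial>M)"
  proof (intro integral_mono)
    show "integrable M (\<lambda>\<omega>. (gap (state s k \<omega>))\<^sup>2 + 4 * real (fst (state s k \<omega>)) * real (snd (state s k \<omega>)))"
      by (rule integrable_state)
    show "integrable M (\<lambda>\<omega>. (gap (state s k \<omega>))\<^sup>2 + (real (fst s + snd s))\<^sup>2)"
      by (rule integrable_state)
    fix \<omega>
    have "4 * real (fst (state s k \<omega>)) * real (snd (state s k \<omega>)) \<le> (real (fst s + snd s) - real k)\<^sup>2"
      using chain_variance_defect(1)[of k s "\<lambda>i. U i \<omega>"] Suc.prems by simp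
    also have "\<dots> \<le> (real (fst s + snd s))\<^sup>2"
      using Suc.prems by (intro power_mono) auto
    finally show "(gap (state s k \<omega>))\<^sup>2 + 4 * real (fst (state s k \<omega>)) * real (snd (state s k \<omega>))
        \<le> (gap (state s k \<omega>))\<^sup>2 + (real (fst s + snd s))\<^sup>2"
      by simp
  qed
  also have "\<dots> = (\<integral>\<omega>. (gap (state s k \<omega>))\<^sup>2 \<partial>M) + (real (fst s + snd s))\<^sup>2"
    by (subst Bochner_Integration.integral_add)
      (auto simp: prob_space intro: integrable_state[where f="\<lambda>p. (gap p)\<^sup>2"])
  finally show ?case
    using Suc by (simp add: algebra_simps)
qed (simp add: prob_space)

text \<open>The defect is at most \<open>a\<close> and has mean at most \<open>b / a\<close>, where \<open>a = (n - k)\<^sup>2\<close> and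
  \<open>b\<close> bounds the second moment, so its mean is at most \<open>\<surd>b\<close>.\<close>

lemma expectation_variance_defect:
  assumes k: "k \<le> fst s + snd s"
  defines "n \<equiv> real (fst s + snd s)"
  shows "(\<integral>\<omega>. (n - real k)\<^sup>2 - 4 * real (fst (state s k \<omega>)) * real (snd (state s k \<omega>)) \<partial>M)
    \<le> sqrt ((gap s)\<^sup>2 + n ^ 3)" (is "?e \<le> _")
proof (rule real_le_rsqrt)
  define d where "d p = (n - real k)\<^sup>2 - 4 * real (fst p) * real (snd p)" for p :: "nat \<times> nat"
  have e: "?e = (\<integral>\<omega>. d (state s k \<omega>) \<partial>M)"
    by (simp add: d_def)
  note defect = chain_variance_defect[OF k, folded n_def, of "\<lambda>i. U i \<omega>" for \<omega>, folded d_def]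
  have e0: "0 \<le> ?e"
    unfolding e using defect(1) by (intro integral_nonneg_AE) auto
  have "?e \<le> (\<integral>\<omega>. (n - real k)\<^sup>2 \<partial>M)"
    unfolding e using defect(2) by (intro integral_mono) auto
  then have e1: "?e \<le> (n - real k)\<^sup>2"
    by (simp add: prob_space)
  have "?e\<^sup>2 \<le> ?e * (n - real k)\<^sup>2"
    using e0 e1 by (simp add: power2_eq_square mult_left_mono)
  also have "\<dots> = (\<integral>\<omega>. d (state s k \<omega>) * (n - real k)\<^sup>2 \<partial>M)"
    unfolding e by simp
  also have "\<dots> \<le> (\<integral>\<omega>. (gap (state s k \<omega>))\<^sup>2 \<partial>M)"
    using defect(3)
    by (intro integral_mono integrable_state[where f="\<lambda>p. d p * (n - real k)\<^sup>2"]
          integrable_state[where f="\<lambda>p. (gap p)\<^sup>2"]) auto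
  also have "\<dots> \<le> (gap s)\<^sup>2 + real k * n\<^sup>2"
    using second_moment_gap[OF k] by (simp add: n_def)
  also have "\<dots> \<le> (gap s)\<^sup>2 + n * n\<^sup>2"
    using k by (intro add_left_mono mult_right_mono) (auto simp: n_def)
  finally show "?e\<^sup>2 \<le> (gap s)\<^sup>2 + n ^ 3"
    by (simp add: power3_eq_cube power2_eq_square)
qed

end

section \<open>Gaussian approximation of the characteristic function\<close>

lemma abs_exp_minus_linear:
  fixes a :: real
  assumes "0 \<le> a"
  shows "\<bar>1 - a - exp (- a)\<bar> \<le> a\<^sup>2"
proof (cases "a \<le> 1")
  case True
  have "1 - a \<le> exp (- a)"
    using exp_ge_add_one_self[of "-a"] by simp
  moreover have "exp (- a) \<le> 1 - a + a\<^sup>2"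
  proof -
    \<comment> \<open>The product equals 1 + a^3.\<close>
    have "1 \<le> (1 - a + a\<^sup>2) * (1 + a)"
      using assms by (simp add: algebra_simps power2_eq_square)
    also have "\<dots> \<le> (1 - a + a\<^sup>2) * exp a"
      using True by (intro mult_left_mono exp_ge_add_one_self) (auto simp: add_nonneg_nonneg)
    finally show ?thesis
      by (simp add: exp_minus field_simps)
  qed
  ultimately show ?thesis
    by simp
next
  case False
  have "a \<le> a\<^sup>2"
    using False by (simp add: power2_eq_square)
  moreover have "0 < exp (- a)" "exp (- a) \<le> 1"
    using assms by simp_all
  ultimately show ?thesis
    using False by linarith
qed

context driven_chain
begin

text \<open>The three error terms are the cubic Taylor remainder, the replacement of 4xy by (n -
  k)^2, which costs \<theta>^2/2 times the mean defect, and the replacement of 1 - a by exp(-a). The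
  factor exp(-a) does not depend on the state, so it leaves the expectation and the recursion
  closes.\<close>

lemma char_gap_step:
  assumes k: "k < fst s + snd s"
  defines "n \<equiv> real (fst s + snd s)"
  shows "cmod ((\<integral>\<omega>. iexp (\<theta> * gap (state s (Suc k) \<omega>)) \<partial>M)
       - exp (- (\<theta>\<^sup>2 / 2 * (n - real k)\<^sup>2)) * (\<integral>\<omega>. iexp (\<theta> * gap (state s k \<omega>)) \<partial>M))
    \<le> 2 * \<bar>\<theta>\<bar> ^ 3 * n ^ 3 + \<theta>\<^sup>2 / 2 * sqrt ((gap s)\<^sup>2 + n ^ 3) + (\<theta>\<^sup>2 / 2 * n\<^sup>2)\<^sup>2"
    (is "cmod (?L - _ * ?R) \<le> ?b")
proof -
  define F where "F p = iexp (\<theta> * gap p)" for p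
  define a where "a = \<theta>\<^sup>2 / 2 * (n - real k)\<^sup>2"
  define v where "v p = (n - real k)\<^sup>2 - 4 * real (fst p) * real (snd p)" for p :: "nat \<times> nat"
  note int = integrable_state[of _ s k]
  have v0: "0 \<le> v (state s k \<omega>)" for \<omega>
    using chain_variance_defect(1)[of k s "\<lambda>i. U i \<omega>"] k by (simp add: v_def n_def)
  have nF: "cmod (F p) = 1" for p
    by (simp add: F_def)
  have "?L - exp (- a) * ?R = (\<integral>\<omega>. step_mean F (state s k \<omega>) - exp (- a) * F (state s k \<omega>) \<partial>M)"
    using expectation_step[of F s k] int[of "step_mean F"] int[of F]
    by (simp add: F_def)
  also have "cmod \<dots> \<le> (\<integral>\<omega>. cmod (step_mean F (state s k \<omega>) - exp (- a) * F (state s k \<omega>)) \<partial>M)"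
    by (rule integral_norm_bound)
  also have "\<dots> \<le> (\<integral>\<omega>. 2 * \<bar>\<theta>\<bar> ^ 3 * n ^ 3 + \<theta>\<^sup>2 / 2 * v (state s k \<omega>) + (\<theta>\<^sup>2 / 2 * n\<^sup>2)\<^sup>2 \<partial>M)"
  proof (rule integral_mono)
    show "integrable M (\<lambda>\<omega>. cmod (step_mean F (state s k \<omega>) - exp (- a) * F (state s k \<omega>)))"
      by (rule int)
    show "integrable M (\<lambda>\<omega>. 2 * \<bar>\<theta>\<bar> ^ 3 * n ^ 3 + \<theta>\<^sup>2 / 2 * v (state s k \<omega>) + (\<theta>\<^sup>2 / 2 * n\<^sup>2)\<^sup>2)"
      by (rule int)
    fix \<omega>
    let ?p = "state s k \<omega>"
    have "real (fst ?p + snd ?p) \<le> n"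
      unfolding n_def of_nat_le_iff using chain_bounds[of s "\<lambda>i. U i \<omega>" k] by simp
    then have le: "(real (fst ?p + snd ?p)) ^ 3 \<le> n ^ 3"
      by (intro power_mono) auto
    have "step_mean F ?p - exp (- a) * F ?p =
        (step_mean F ?p - F ?p * complex_of_real (1 - \<theta>\<^sup>2 / 2 * (4 * real (fst ?p) * real (snd ?p))))
        + F ?p * complex_of_real (\<theta>\<^sup>2 / 2 * v ?p)
        + F ?p * complex_of_real (1 - a - exp (- a))"
      by (simp add: v_def a_def exp_of_real algebra_simps)
    also have "cmod \<dots> \<le> cmod (step_mean F ?p - F ?p * complex_of_real (1 - \<theta>\<^sup>2 / 2 * (4 * real (fst ?p) * real (snd ?p))))
        + cmod (F ?p * complex_of_real (\<theta>\<^sup>2 / 2 * v ?p)) + cmod (F ?p * complex_of_real (1 - a - exp (- a)))"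
      by (intro norm_triangle_le add_mono) simp_all
    also have "cmod (F ?p * complex_of_real (\<theta>\<^sup>2 / 2 * v ?p)) = \<theta>\<^sup>2 / 2 * v ?p"
      unfolding norm_mult nF norm_of_real using v0[of \<omega>] by (simp add: abs_mult)
    also have "cmod (F ?p * complex_of_real (1 - a - exp (- a))) = \<bar>1 - a - exp (- a)\<bar>"
      unfolding norm_mult nF norm_of_real by simp
    also have "\<bar>1 - a - exp (- a)\<bar> \<le> a\<^sup>2"
      by (rule abs_exp_minus_linear) (simp add: a_def)
    also have "a\<^sup>2 \<le> (\<theta>\<^sup>2 / 2 * n\<^sup>2)\<^sup>2"
      unfolding a_def using k by (intro power_mono mult_left_mono) (auto simp: n_def)
    also have "cmod (step_mean F ?p - F ?p * complex_of_real (1 - \<theta>\<^sup>2 / 2 * (4 * real (fst ?p) * real (snd ?p))))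
        \<le> 2 * \<bar>\<theta>\<bar> ^ 3 * (real (fst ?p + snd ?p)) ^ 3"
      unfolding F_def by (rule step_mean_iexp_gap)
    also have "\<dots> \<le> 2 * \<bar>\<theta>\<bar> ^ 3 * n ^ 3"
      using le by (intro mult_left_mono) auto
    finally show "cmod (step_mean F ?p - exp (- a) * F ?p)
        \<le> 2 * \<bar>\<theta>\<bar> ^ 3 * n ^ 3 + \<theta>\<^sup>2 / 2 * v ?p + (\<theta>\<^sup>2 / 2 * n\<^sup>2)\<^sup>2"
      by simp
  qed
  also have "\<dots> = 2 * \<bar>\<theta>\<bar> ^ 3 * n ^ 3 + \<theta>\<^sup>2 / 2 * (\<integral>\<omega>. v (state s k \<omega>) \<partial>M) + (\<theta>\<^sup>2 / 2 * n\<^sup>2)\<^sup>2"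
    using int[of v] by (simp add: prob_space)
  also have "\<dots> \<le> ?b"
    using expectation_variance_defect[of k s] k
    by (intro add_mono mult_left_mono order_refl) (auto simp: v_def n_def)
  finally show ?thesis
    by (simp add: a_def exp_of_real)
qed

text \<open>The factors exp(-a) are at most 1, so the one-step errors add up without amplification.
  For \<theta> of order N^(-3/2), n of order N and an initial gap of order N^(3/2), the three
  contributions over n steps are of order N^(-1/2), N^(-1/2) and N^(-1).\<close>

lemma char_gap:
  assumes k: "k \<le> fst s + snd s"
  defines "n \<equiv> real (fst s + snd s)"
  shows "cmod ((\<integral>\<omega>. iexp (\<theta> * gap (state s k \<omega>)) \<partial>M)
       - exp (- (\<theta>\<^sup>2 / 2 * (\<Sum>j<k. (n - real j)\<^sup>2))) * iexp (\<theta> * gap s))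
    \<le> real k * (2 * \<bar>\<theta>\<bar> ^ 3 * n ^ 3 + \<theta>\<^sup>2 / 2 * sqrt ((gap s)\<^sup>2 + n ^ 3) + (\<theta>\<^sup>2 / 2 * n\<^sup>2)\<^sup>2)"
  using k
proof (induction k)
  case (Suc k)
  let ?b = "2 * \<bar>\<theta>\<bar> ^ 3 * n ^ 3 + \<theta>\<^sup>2 / 2 * sqrt ((gap s)\<^sup>2 + n ^ 3) + (\<theta>\<^sup>2 / 2 * n\<^sup>2)\<^sup>2"
  define G where "G k = (\<integral>\<omega>. iexp (\<theta> * gap (state s k \<omega>)) \<partial>M)" for k
  define a where "a = \<theta>\<^sup>2 / 2 * (n - real k)\<^sup>2"
  define D where "D = G k - exp (- (\<theta>\<^sup>2 / 2 * (\<Sum>j<k. (n - real j)\<^sup>2))) * iexp (\<theta> * gap s)"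
  have IH: "cmod D \<le> real k * ?b"
    using Suc by (simp add: D_def G_def)
  have step: "cmod (G (Suc k) - exp (- a) * G k) \<le> ?b"
    using char_gap_step[of k s \<theta>] Suc.prems unfolding G_def a_def n_def by simp
  have "exp (- (\<theta>\<^sup>2 / 2 * (\<Sum>j<Suc k. (n - real j)\<^sup>2))) = exp (- a) * exp (- (\<theta>\<^sup>2 / 2 * (\<Sum>j<k. (n - real j)\<^sup>2)))"
    by (simp add: a_def exp_add[symmetric] algebra_simps)
  then have "G (Suc k) - exp (- (\<theta>\<^sup>2 / 2 * (\<Sum>j<Suc k. (n - real j)\<^sup>2))) * iexp (\<theta> * gap s)
      = (G (Suc k) - exp (- a) * G k) + exp (- a) * D"
    by (simp add: D_def algebra_simps)
  also have "cmod \<dots> \<le> cmod (G (Suc k) - exp (- a) * G k) + exp (- a) * cmod D"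
    by (rule order_trans[OF norm_triangle_ineq]) (simp add: norm_mult)
  also have "\<dots> \<le> ?b + 1 * (real k * ?b)"
    using IH step by (intro add_mono mult_mono) (auto simp: a_def)
  also have "\<dots> = real (Suc k) * ?b"
    by (simp only: of_nat_Suc distrib_right mult_1_left)
  finally show ?case
    by (simp only: G_def)
qed (simp add: prob_space)

end

subsection \<open>The ruin time\<close>

text \<open>Nonnegative waiting times make the counted indices an initial segment of the positive
  integers; unboundedness makes it finite, so that \<open>card\<close> is not the default 0. For l =
  0 and negative t the left side would hold and the right side fail.\<close>

lemma poisson_count_ge_iff:
  assumes nonneg: "\<And>i. 0 \<le> e i" and unbounded: "\<And>t. \<exists>k. t < (\<Sum>i<k. e i)" and l: "0 < l"
  shows "l \<le> poisson_count e t \<longleftrightarrow> (\<Sum>i<l. e i) \<le> t"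
proof -
  define A where "A = {k. 0 < k \<and> (\<Sum>i<k. e i) \<le> t}"
  have mono: "(\<Sum>i<j. e i) \<le> (\<Sum>i<k. e i)" if "j \<le> k" for j k
    using that nonneg by (intro sum_mono2) auto
  have bound: "A \<subseteq> {1..<k}" if "t < (\<Sum>i<k. e i)" for k
  proof
    fix j assume "j \<in> A"
    then show "j \<in> {1..<k}"
      using that mono[of k j] by (cases "k \<le> j") (auto simp: A_def)
  qed
  have fin: "finite A"
    using unbounded[of t] bound finite_subset by blast
  show ?thesis
  proof
    assume le: "(\<Sum>i<l. e i) \<le> t"
    then have "{1..l} \<subseteq> A"
      by (auto simp: A_def intro: order_trans[OF mono])
    then have "card {1..l} \<le> card A"
      by (rule card_mono[OF fin])
    then show "l \<le> poisson_count e t"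
      by (simp add: poisson_count_def A_def)
  next
    assume le: "l \<le> poisson_count e t"
    show "(\<Sum>i<l. e i) \<le> t"
    proof (rule ccontr)
      assume "\<not> (\<Sum>i<l. e i) \<le> t"
      then have "card A \<le> card {1..<l}"
        by (intro card_mono bound) auto
      then show False
        using le l by (simp add: poisson_count_def A_def)
    qed
  qed
qed

lemma min_scaled_eq_0_iff:
  assumes "0 < N"
  shows "min (real a / real N) (real b / real N) = 0 \<longleftrightarrow> a = 0 \<or> b = 0"
  using assms by (auto simp: min_def field_simps)

lemma ruin_time_eq:
  assumes N: "0 < N" and s: "\<not> absorbed s"
    and nonneg: "\<And>i. 0 \<le> e i" and unbounded: "\<And>t. \<exists>k. t < (\<Sum>i<k. e i)"
  shows "ruin_time N s e u = (\<Sum>i<fst s + snd s - survivors s u. e i) / real N"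
proof -
  define l where "l = fst s + snd s - survivors s u"
  define c where "c = (\<Sum>i<l. e i) / real N"
  have "\<not> l \<le> 0"
    using absorbed_chain_iff[of s u 0] s by (simp add: l_def)
  then have "absorbed (proc s e u (real N * t)) \<longleftrightarrow> c \<le> t" for t
    unfolding proc_def absorbed_chain_iff l_def[symmetric]
    using poisson_count_ge_iff[OF nonneg unbounded, of l "real N * t"] N
    by (simp add: c_def field_simps)
  then have "ruin_time N s e u = Inf {t. 0 < t \<and> c \<le> t}"
    unfolding ruin_time_def min_scaled_eq_0_iff[OF N] by simp
  \<comment> \<open>c may be 0, and then 0 < t keeps it out of the set; the infimum is therefore
    approached from above by density.\<close>
  also have "\<dots> = c"
  proof (rule cInf_eq)
    show "c \<le> t" if "t \<in> {t. 0 < t \<and> c \<le> t}" for t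
      using that by simp
    have c0: "0 \<le> c"
      by (auto simp: c_def intro!: divide_nonneg_nonneg sum_nonneg nonneg)
    fix y assume y: "\<And>t. t \<in> {t. 0 < t \<and> c \<le> t} \<Longrightarrow> y \<le> t"
    show "y \<le> c"
    proof (rule dense_ge)
      fix t assume "c < t" then show "y \<le> t" using y[of t] c0 by simp
    qed
  qed
  finally show ?thesis
    by (simp add: c_def l_def)
qed

text \<open>The infimum in \<^const>\<open>ruin_time\<close> ranges over uncountably many times. On every open
  interval the counting function already takes all its values at rational times and at jump times;
  this also covers driving sequences for which infinitely many partial sums stay bounded, where
  \<^const>\<open>card\<close> is the junk value 0.\<close>

lemma poisson_count_skeleton:
  assumes t: "a < t" "t < b"
  obtains t' where "a < t'" "t' < b" "poisson_count e t' = poisson_count e t"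
    "t' \<in> \<rat> \<or> (\<exists>k. t' = (\<Sum>i<k. e i))"
proof -
  define A where "A t = {k. 0 < k \<and> (\<Sum>i<k. e i) \<le> t}" for t
  have count: "poisson_count e t = card (A t)" for t
    by (simp add: poisson_count_def A_def)
  have mono: "A r \<subseteq> A r'" if "r \<le> r'" for r r'
    using that by (auto simp: A_def)
  show thesis
  proof (cases "\<exists>k. t = (\<Sum>i<k. e i)")
    case True
    then show thesis
      using that t by blast
  next
    case no_jump: False
    show thesis
    proof (cases "finite (A t)")
      case True
      \<comment> \<open>\<open>m\<close> is the last partial sum up to t, or a if that is larger. As
        t is no partial sum, m < t, and no jump falls into the interval from m to t, so a rational
        there gives the same count.\<close>
      define m where "m = Max (insert a ((\<lambda>k. \<Sum>i<k. e i) ` A t))"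
      have fin: "finite (insert a ((\<lambda>k. \<Sum>i<k. e i) ` A t))"
        using True by simp
      have "m \<in> insert a ((\<lambda>k. \<Sum>i<k. e i) ` A t)"
        unfolding m_def by (rule Max_in[OF fin]) simp
      then have "m < t"
        using t no_jump by (auto simp: A_def order.order_iff_strict)
      then obtain q where q: "q \<in> \<rat>" "m < q" "q < t"
        using Rats_dense_in_real by blast
      have "a \<le> m"
        unfolding m_def by (rule Max_ge[OF fin]) simp
      have "A t \<subseteq> A q"
      proof
        fix k assume k: "k \<in> A t"
        then have "(\<Sum>i<k. e i) \<le> m"
          unfolding m_def by (intro Max_ge[OF fin]) simp
        then show "k \<in> A q"
          using k q by (simp add: A_def)
      qed
      then have "A q = A t"
        using mono[of q t] q by simp
      then show thesis
        using that[of q] q t \<open>a \<le> m\<close> by (simp add: count)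
    next
      case False
      \<comment> \<open>Here the counted set is infinite at t and remains so at every later time;
        both counts are the default 0.\<close>
      obtain q where q: "q \<in> \<rat>" "t < q" "q < b"
        using Rats_dense_in_real t by blast
      have "infinite (A q)"
        using False mono[of t q] q finite_subset by auto
      then show thesis
        using that[of q] q t False by (simp add: count)
    qed
  qed
qed

text \<open>The formula \<open>ruin_time_eq\<close> is available only almost surely, which does not
  yield measurability on a space that may be incomplete. So all driving sequences are treated, and
  the uncountable search for t is reduced to rational times and jump times.\<close>

lemma measurable_ruin_time:
  assumes [measurable]: "\<And>i. e i \<in> borel_measurable M" "\<And>i. u i \<in> borel_measurable M"
  shows "(\<lambda>\<omega>. ruin_time N s (\<lambda>i. e i \<omega>) (\<lambda>i. u i \<omega>)) \<in> borel_measurable M"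
proof (cases "N = 0")
  case False
  then have N: "0 < N" by simp
  define P where "P \<omega> t \<longleftrightarrow> absorbed (proc s (\<lambda>i. e i \<omega>) (\<lambda>i. u i \<omega>) t)" for \<omega> t
  have P [measurable]: "Measurable.pred M (\<lambda>\<omega>. P \<omega> (\<tau> \<omega>))" if [measurable]: "\<tau> \<in> borel_measurable M" for \<tau>
  proof -
    have [measurable]: "(\<lambda>\<omega>. chain s (\<lambda>i. u i \<omega>) k) \<in> M \<rightarrow>\<^sub>M count_space UNIV" for k
      by (rule measurable_chain) simp
    have [measurable]: "(\<lambda>\<omega>. poisson_count (\<lambda>i. e i \<omega>) (\<tau> \<omega>)) \<in> M \<rightarrow>\<^sub>M count_space UNIV"
      unfolding poisson_count_def by measurable
    show ?thesis
      unfolding P_def proc_def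
      by (rule measurable_compose_countable[where g="\<lambda>\<omega>. poisson_count (\<lambda>i. e i \<omega>) (\<tau> \<omega>)"]) measurable
  qed
  define Q where "Q \<omega> c \<longleftrightarrow> (\<exists>t. 0 < t \<and> t < c \<and> P \<omega> (real N * t))" for \<omega> c
  have Q_iff: "Q \<omega> c \<longleftrightarrow>
      (\<exists>q::rat. 0 < real_of_rat q \<and> real_of_rat q < real N * c \<and> P \<omega> (real_of_rat q)) \<or>
      (\<exists>k. 0 < (\<Sum>i<k. e i \<omega>) \<and> (\<Sum>i<k. e i \<omega>) < real N * c \<and> P \<omega> (\<Sum>i<k. e i \<omega>))" (is "_ \<longleftrightarrow> ?R")
    for \<omega> c
  proof
    assume "Q \<omega> c"
    then obtain t where t: "0 < t" "t < c" "P \<omega> (real N * t)"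
      by (auto simp: Q_def)
    obtain t' where "0 < t'" "t' < real N * c"
      "poisson_count (\<lambda>i. e i \<omega>) t' = poisson_count (\<lambda>i. e i \<omega>) (real N * t)"
      "t' \<in> \<rat> \<or> (\<exists>k. t' = (\<Sum>i<k. e i \<omega>))"
      by (rule poisson_count_skeleton[of 0 "real N * t" "real N * c" "\<lambda>i. e i \<omega>"]) (use t N in auto)
    moreover from this(3) have "P \<omega> t'"
      using t by (simp add: P_def proc_def)
    ultimately show ?R
      by (auto simp: Rats_def)
  next
    have *: "Q \<omega> c" if "0 < r" "r < real N * c" "P \<omega> r" for r
      using that N by (auto simp: Q_def field_simps intro!: exI[of _ "r / real N"])
    assume ?R
    then show "Q \<omega> c"
      using * by blast
  qed
  have [measurable]: "Measurable.pred M (\<lambda>\<omega>. Q \<omega> c)" for c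
    unfolding Q_iff by measurable
  define S where "S \<omega> = {t. 0 < t \<and> P \<omega> (real N * t)}" for \<omega>
  have ruin: "ruin_time N s (\<lambda>i. e i \<omega>) (\<lambda>i. u i \<omega>) = Inf (S \<omega>)" for \<omega>
    unfolding ruin_time_def min_scaled_eq_0_iff[OF N] by (simp add: S_def P_def)
  have S_ne: "S \<omega> \<noteq> {} \<longleftrightarrow> (\<exists>n::nat. Q \<omega> (real n))" for \<omega>
    using reals_Archimedean2 by (fastforce simp: S_def Q_def)
  \<comment> \<open>On an empty set \<open>Inf\<close> is one fixed real, so there the comparison
    with c does not depend on \<omega>.\<close>
  have Inf_less: "Inf (S \<omega>) < c \<longleftrightarrow> (if \<exists>n::nat. Q \<omega> (real n) then Q \<omega> c else Inf {} < c)" for \<omega> c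
  proof (cases "S \<omega> = {}")
    case False
    have "bdd_below (S \<omega>)"
      by (rule bdd_belowI[of _ 0]) (auto simp: S_def)
    then have "Inf (S \<omega>) < c \<longleftrightarrow> Q \<omega> c"
      using cInf_less_iff[OF False] by (auto simp: S_def Q_def)
    then show ?thesis
      using False S_ne by simp
  next
    case True
    then show ?thesis
      using S_ne[of \<omega>] by auto
  qed
  show ?thesis
    unfolding ruin borel_measurable_iff_less Inf_less by measurable
\<comment> \<open>For N = 0 division by zero makes the ruin condition hold always, so the ruin time
  is constant.\<close>
qed (simp add: ruin_time_def)

section \<open>Fluctuations of the Poisson clock\<close>

context driven_chain
begin

lemma centred_clock_moment:
  shows "integrable M (\<lambda>\<omega>. ((\<Sum>i<l. E i \<omega>) - real l)\<^sup>2)" (is "?int l")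
    and "(\<integral>\<omega>. ((\<Sum>i<l. E i \<omega>) - real l)\<^sup>2 \<partial>M) = real l" (is "?eq l")
proof -
  let ?X = "\<lambda>i. case i of Inl k \<Rightarrow> E k | Inr k \<Rightarrow> U k"
  define Z where "Z l \<omega> = (\<Sum>i<l. E i \<omega>) - real l" for l \<omega>
  have int: "integrable M (E k)" "integrable M (\<lambda>\<omega>. (E k \<omega>)\<^sup>2)" for k
    using erlang_ith_moment_integrable[OF _ E_distributed[of k], of 1]
      erlang_ith_moment_integrable[OF _ E_distributed[of k], of 2] by simp_all
  have mean: "expectation (E k) = 1" and sq: "expectation (\<lambda>\<omega>. (E k \<omega>)\<^sup>2) = 2" for k
    using erlang_ith_moment[OF _ E_distributed[of k], of 1]
      erlang_ith_moment[OF _ E_distributed[of k], of 2] by (simp_all add: fact_2)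
  have intZ: "integrable M (Z l)" for l
    unfolding Z_def using int by simp
  have meanZ: "expectation (Z l) = 0" for l
    unfolding Z_def using int by (simp add: mean prob_space)
  have "integrable M (\<lambda>\<omega>. (Z l \<omega>)\<^sup>2) \<and> expectation (\<lambda>\<omega>. (Z l \<omega>)\<^sup>2) = real l"
  proof (induction l)
    case 0
    then show ?case by (simp add: Z_def)
  next
    case (Suc l)
    have ind: "indep_var borel (E l) borel (\<lambda>\<omega>. \<Sum>i\<in>Inl ` {..<l}. ?X i \<omega>)"
      using indep_vars_sum[of "Inl ` {..<l}" "Inl l" ?X] indep_vars_subset[OF indep] by auto
    have "indep_var borel ((\<lambda>x. x - 1) \<circ> E l) borel ((\<lambda>x. x - real l) \<circ> (\<lambda>\<omega>. \<Sum>i\<in>Inl ` {..<l}. ?X i \<omega>))"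
      by (rule indep_var_compose[OF ind]) auto
    moreover have "(\<Sum>i\<in>Inl ` {..<l}. ?X i \<omega>) = (\<Sum>i<l. E i \<omega>)" for \<omega>
      by (subst sum.reindex) auto
    ultimately have ind': "indep_var borel (\<lambda>\<omega>. E l \<omega> - 1) borel (Z l)"
      by (simp add: comp_def Z_def[abs_def])
    have int1: "integrable M (\<lambda>\<omega>. E l \<omega> - 1)"
      using int by simp
    have cross: "integrable M (\<lambda>\<omega>. (E l \<omega> - 1) * Z l \<omega>)" "expectation (\<lambda>\<omega>. (E l \<omega> - 1) * Z l \<omega>) = 0"
      using indep_var_integrable[OF ind' int1 intZ] indep_var_lebesgue_integral[OF ind' int1 intZ]
      by (simp_all add: meanZ)
    \<comment> \<open>The cross term has mean 0 by independence, and the last bracket has mean 2 - 2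
      + 1 = 1, the variance of one waiting time.\<close>
    have expand: "(Z (Suc l) \<omega>)\<^sup>2 = (Z l \<omega>)\<^sup>2 + 2 * ((E l \<omega> - 1) * Z l \<omega>) + ((E l \<omega>)\<^sup>2 - 2 * E l \<omega> + 1)" for \<omega>
      by (simp add: Z_def power2_eq_square algebra_simps)
    show ?case
      unfolding expand using Suc cross int[of l] by (simp add: mean sq prob_space)
  qed
  then show "?int l" "?eq l"
    by (simp_all add: Z_def)
qed

lemma AE_E_nonneg: "AE \<omega> in M. \<forall>i. 0 \<le> E i \<omega>"
  unfolding AE_all_countable
  by (subst distributed_AE2[OF E_distributed]) (auto simp: exponential_density_def)

text \<open>Chebyshev: if all partial sums stay below a, then the k-th one is at least k - a below
  its mean, an event of probability at most k / (k - a)^2. Natural a suffice, which keeps the union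
  of null sets countable.\<close>

lemma AE_clock_unbounded: "AE \<omega> in M. \<forall>t. \<exists>k. t < (\<Sum>i<k. E i \<omega>)"
proof -
  have "AE \<omega> in M. \<exists>k. real a < (\<Sum>i<k. E i \<omega>)" for a :: nat
  proof -
    define A where "A = {\<omega> \<in> space M. \<forall>k. (\<Sum>i<k. E i \<omega>) \<le> real a}"
    have [measurable]: "A \<in> sets M"
      unfolding A_def by measurable
    have bound: "prob A \<le> real k / (real k - real a)\<^sup>2" if k: "a < k" for k
    proof -
      have "(\<integral>\<omega>. (real k - real a)\<^sup>2 * indicator A \<omega> \<partial>M) \<le> (\<integral>\<omega>. ((\<Sum>i<k. E i \<omega>) - real k)\<^sup>2 \<partial>M)"
      proof (rule integral_mono)
        fix \<omega> assume "\<omega> \<in> space M"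
        have "(real k - real a)\<^sup>2 \<le> ((\<Sum>i<k. E i \<omega>) - real k)\<^sup>2" if "\<omega> \<in> A"
        proof -
          have "(\<Sum>i<k. E i \<omega>) \<le> real a"
            using that by (simp add: A_def)
          then have "(real k - real a)\<^sup>2 \<le> (real k - (\<Sum>i<k. E i \<omega>))\<^sup>2"
            using k by (intro power_mono) auto
          then show ?thesis
            by (simp add: power2_commute)
        qed
        then show "(real k - real a)\<^sup>2 * indicator A \<omega> \<le> ((\<Sum>i<k. E i \<omega>) - real k)\<^sup>2"
          by (auto simp: indicator_def)
      qed (auto simp: centred_clock_moment less_top[symmetric])
      then have "(real k - real a)\<^sup>2 * prob A \<le> real k"
        by (simp add: centred_clock_moment)
      then show ?thesis
        using k by (simp add: field_simps)
    qed
    have "prob A \<le> 0"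
    proof (rule tendsto_lowerbound)
      show "(\<lambda>k. real k / (real k - real a)\<^sup>2) \<longlonglongrightarrow> 0"
        by real_asymp
      show "eventually (\<lambda>k. prob A \<le> real k / (real k - real a)\<^sup>2) sequentially"
        using bound by (auto intro!: eventually_sequentiallyI[of "Suc a"])
    qed simp
    then have "prob A = 0"
      by (simp add: antisym)
    then show ?thesis
      by (intro AE_I[of _ _ A]) (auto simp: A_def emeasure_eq_measure not_less)
  qed
  then have "AE \<omega> in M. \<forall>a::nat. \<exists>k. real a < (\<Sum>i<k. E i \<omega>)"
    by (simp add: AE_all_countable)
  then show ?thesis
    by eventually_elim (meson less_trans reals_Archimedean2)
qed

text \<open>The number of jumps before ruin depends on \<open>U\<close> only, so it may be conditioned on.\<close>

lemma centred_ruin_clock_moment: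
  fixes s
  defines "l \<omega> \<equiv> fst s + snd s - survivors s (\<lambda>i. U i \<omega>)"
  shows "integrable M (\<lambda>\<omega>. ((\<Sum>i<l \<omega>. E i \<omega>) - real (l \<omega>))\<^sup>2)"
    and "(\<integral>\<omega>. ((\<Sum>i<l \<omega>. E i \<omega>) - real (l \<omega>))\<^sup>2 \<partial>M) \<le> real (fst s + snd s)"
proof -
  let ?X = "\<lambda>i. case i of Inl k \<Rightarrow> E k | Inr k \<Rightarrow> U k"
  define n where "n = fst s + snd s"
  define A :: "(nat + nat) set" where "A = Inr ` {..<n}"
  define g where "g f = n - survivors s (\<lambda>i. f (Inr i))" for f :: "nat + nat \<Rightarrow> real"
  have g [measurable]: "g \<in> PiM A (\<lambda>_. borel) \<rightarrow>\<^sub>M count_space UNIV"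
  proof -
    have [measurable]: "(\<lambda>f. chain s (\<lambda>i. f (Inr i)) n) \<in> PiM A (\<lambda>_. borel) \<rightarrow>\<^sub>M count_space UNIV"
      by (rule measurable_chain) (auto simp: A_def)
    show ?thesis
      unfolding g_def[abs_def] survivors_def n_def[symmetric] by measurable
  qed
  have l: "l \<omega> = g (restrict (\<lambda>i. ?X i \<omega>) A)" for \<omega>
  proof -
    have "chain s (\<lambda>i. restrict (\<lambda>i. ?X i \<omega>) A (Inr i)) n = state s n \<omega>"
      by (rule chain_cong) (auto simp: A_def)
    then show ?thesis
      by (simp add: l_def g_def survivors_def n_def)
  qed
  define Z where "Z k \<omega> = ((\<Sum>i<k. E i \<omega>) - real k)\<^sup>2" for k \<omega>
  define I where "I k \<omega> = (if l \<omega> = k then 1 else 0 :: real)" for k \<omega>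
  have ind: "indep_var borel (I k) borel (Z k)" for k
  proof -
    define B :: "(nat + nat) set" where "B = Inl ` {..<k}"
    have "indep_var
        borel ((\<lambda>f. if g f = k then 1 else 0 :: real) \<circ> (\<lambda>\<omega>. restrict (\<lambda>i. ?X i \<omega>) A))
        borel ((\<lambda>f. ((\<Sum>i<k. f (Inl i)) - real k)\<^sup>2) \<circ> (\<lambda>\<omega>. restrict (\<lambda>i. ?X i \<omega>) B))"
    proof (intro indep_var_compose[OF indep_var_restrict[OF indep]])
      have [measurable]: "(\<lambda>f. f (Inl i)) \<in> borel_measurable (PiM B (\<lambda>_. borel))" if "i < k" for i
        using that by (auto simp: B_def)
      show "(\<lambda>f. ((\<Sum>i<k. f (Inl i)) - real k)\<^sup>2) \<in> borel_measurable (PiM B (\<lambda>_. borel))"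
        by (intro borel_measurable_power borel_measurable_diff borel_measurable_sum) auto
      show "(\<lambda>f. if g f = k then 1 else 0 :: real) \<in> borel_measurable (PiM A (\<lambda>_. borel))"
        by measurable
    qed (auto simp: A_def B_def)
    then show ?thesis
      by (simp add: comp_def I_def[abs_def] Z_def[abs_def] l B_def)
  qed
  have intI: "integrable M (I k)" for k
  proof (rule integrable_const_bound[of _ 1])
    show "random_variable borel (I k)"
      using ind[of k] by (rule indep_var_rv1)
  qed (auto simp: I_def)
  have intZ: "integrable M (Z k)" and meanZ: "expectation (Z k) = real k" for k
    using centred_clock_moment[of k] by (simp_all add: Z_def[abs_def])
  have l_le: "l \<omega> \<in> {..n}" for \<omega>
    by (simp add: l_def n_def)
  \<comment> \<open>Only the term with k = l survives. \<open>I k\<close> depends on the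
    \<open>Inr\<close> coordinates and \<open>Z k\<close> on the \<open>Inl\<close> coordinates, so
    every product factorises; this replaces conditional expectations.\<close>
  have split: "((\<Sum>i<l \<omega>. E i \<omega>) - real (l \<omega>))\<^sup>2 = (\<Sum>k\<le>n. I k \<omega> * Z k \<omega>)" for \<omega>
    using l_le[of \<omega>] by (simp add: I_def Z_def if_distrib[of "\<lambda>x. x * _"] sum.delta cong: if_cong)
  have intIZ: "integrable M (\<lambda>\<omega>. I k \<omega> * Z k \<omega>)" for k
    by (rule indep_var_integrable[OF ind intI intZ])
  then show "integrable M (\<lambda>\<omega>. ((\<Sum>i<l \<omega>. E i \<omega>) - real (l \<omega>))\<^sup>2)"
    unfolding split by simp
  have "(\<integral>\<omega>. ((\<Sum>i<l \<omega>. E i \<omega>) - real (l \<omega>))\<^sup>2 \<partial>M) = (\<Sum>k\<le>n. expectation (I k) * real k)"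
    unfolding split using intIZ
    by (simp add: indep_var_lebesgue_integral[OF ind intI intZ] meanZ)
  also have "\<dots> \<le> (\<Sum>k\<le>n. expectation (I k) * real n)"
    by (intro sum_mono mult_left_mono integral_nonneg_AE) (auto simp: I_def)
  also have "\<dots> = expectation (\<lambda>\<omega>. \<Sum>k\<le>n. I k \<omega>) * real n"
    using intI by (simp add: sum_distrib_right)
  also have "(\<lambda>\<omega>. \<Sum>k\<le>n. I k \<omega>) = (\<lambda>_. 1)"
    using l_le by (auto simp: I_def fun_eq_iff)
  finally show "(\<integral>\<omega>. ((\<Sum>i<l \<omega>. E i \<omega>) - real (l \<omega>))\<^sup>2 \<partial>M) \<le> real (fst s + snd s)"
    by (simp add: prob_space n_def)
qed

end

subsection \<open>Absolute moments of a shifted normal variable\<close>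

text \<open>The quotient |a + n| / (b + n) is at most C = |a|/b + 1, so the series is dominated by
  an exponential series.\<close>

lemma summable_kummer:
  fixes a b z :: real
  assumes b: "0 < b"
  shows "summable (\<lambda>n. norm (pochhammer a n / (pochhammer b n * fact n) * z ^ n))"
proof (rule summable_comparison_test')
  define C where "C = \<bar>a\<bar> / b + 1"
  have C: "\<bar>a + real n\<bar> \<le> C * (b + real n)" for n
  proof -
    have "\<bar>a\<bar> \<le> \<bar>a\<bar> / b * (b + real n)"
      using b by (simp add: field_simps)
    then show ?thesis
      using b by (simp add: C_def distrib_right)
  qed
  have "\<bar>pochhammer a n\<bar> \<le> C ^ n * pochhammer b n" for n
  proof (induction n)
    case (Suc n)
    have "\<bar>pochhammer a (Suc n)\<bar> \<le> (C ^ n * pochhammer b n) * (C * (b + real n))"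
      unfolding pochhammer_Suc abs_mult using Suc C by (intro mult_mono) auto
    then show ?case
      by (simp add: pochhammer_Suc mult_ac)
  qed simp
  then have "\<bar>pochhammer a n\<bar> * \<bar>z\<bar> ^ n \<le> (C ^ n * pochhammer b n) * \<bar>z\<bar> ^ n" for n
    by (intro mult_right_mono) auto
  then show "norm (norm (pochhammer a n / (pochhammer b n * fact n) * z ^ n)) \<le> (C * \<bar>z\<bar>) ^ n / fact n" for n
    using b pochhammer_pos[of b n]
    by (simp add: abs_mult power_abs power_mult_distrib field_simps)
  show "summable (\<lambda>n. (C * \<bar>z\<bar>) ^ n / fact n)"
    using summable_exp_generic[of "C * \<bar>z\<bar>"] by (simp add: field_simps)
qed

text \<open>The coefficients of the Cauchy product with exp(-x) become a Chu-Vandermonde sum once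
  the binomial coefficient is written as a rising factorial of -n.\<close>

lemma kummer_transformation:
  assumes b: "0 < b"
  shows "kummerM a b x * exp (- x) = kummerM (b - a) b (- x)"
proof -
  define f where "f n = pochhammer a n / (pochhammer b n * fact n) * x ^ n" for n
  define g where "g n = (- x) ^ n / fact n" for n
  have pb: "pochhammer b n \<noteq> 0" for n
    using pochhammer_pos[OF b, of n] by simp
  have g_sums: "(\<lambda>n. g n) sums exp (- x)"
    using exp_converges[of "-x"] by (simp add: g_def field_simps)
  have "summable (\<lambda>n. norm (g n))"
    using summable_norm_exp[of "-x"] by (simp add: g_def field_simps)
  then have "(\<lambda>n. \<Sum>i\<le>n. f i * g (n - i)) sums ((\<Sum>n. f n) * (\<Sum>n. g n))"
    using summable_kummer[OF b] by (intro Cauchy_product_sums) (auto simp: f_def)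
  moreover have "(\<Sum>i\<le>n. f i * g (n - i)) = pochhammer (b - a) n / (pochhammer b n * fact n) * (- x) ^ n" for n
  proof -
    have "f i * g (n - i) = (- x) ^ n / fact n *
        (pochhammer a i * pochhammer (- real n) i / (of_nat (fact i) * pochhammer b i))" if "i \<le> n" for i
    proof -
      have "pochhammer (- real n) i = (- 1) ^ i * fact i * real (n choose i)"
        by (simp add: binomial_gbinomial gbinomial_pochhammer)
      also have "real (n choose i) = fact n / (fact i * fact (n - i))"
        using that by (rule binomial_fact)
      finally have poch: "pochhammer (- real n) i = (- 1) ^ i * fact n / fact (n - i)"
        by simp
      have "x ^ i * (- x) ^ (n - i) = (- 1) ^ i * (- x) ^ n"
        using that by (subst power_minus[of x n], subst power_minus[of x "n - i"])
          (simp flip: power_add mult.assoc add: minus_one_power_iff)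
      then show ?thesis
        unfolding f_def g_def poch using pb[of i] by (simp add: field_simps)
    qed
    then have "(\<Sum>i\<le>n. f i * g (n - i)) = (- x) ^ n / fact n *
        (\<Sum>i=0..n. pochhammer a i * pochhammer (- real n) i / (of_nat (fact i) * pochhammer b i))"
      by (simp add: sum_distrib_left atMost_atLeast0)
    also have "(\<Sum>i=0..n. pochhammer a i * pochhammer (- real n) i / (of_nat (fact i) * pochhammer b i))
        = pochhammer (b - a) n / pochhammer b n"
      using b by (intro Vandermonde_pochhammer) (auto simp: add_eq_0_iff)
    finally show ?thesis
      by (simp add: mult.commute)
  qed
  ultimately show ?thesis
    using sums_unique[OF g_sums]
    by (simp add: kummerM_def f_def[abs_def] sums_iff)
qed

text \<open>Substitute t = w^2/2 in Euler's integral for Gamma((s + 1)/2); the open half-line makes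
  the substitution injective. The nonnegative integral prepares for termwise integration.\<close>

lemma nn_integral_half_gaussian_moment:
  assumes s: "- 1 < s"
  shows "(\<integral>\<^sup>+w. ennreal (indicator {0<..} w * (w powr s * exp (- w\<^sup>2 / 2))) \<partial>lborel)
    = ennreal (2 powr ((s - 1) / 2) * Gamma ((s + 1) / 2))"
proof -
  define r where "r = (s + 1) / 2"
  define f where "f t = t powr (r - 1) / exp t" for t :: real
  define h where "h w = \<bar>w\<bar> * f (w\<^sup>2 / 2)" for w :: real
  have r: "0 < r" using s by (simp add: r_def)
  have img: "(\<lambda>w::real. w\<^sup>2 / 2) ` {0<..} = {0<..}"
  proof (intro equalityI subsetI)
    fix t :: real assume "t \<in> {0<..}"
    then show "t \<in> (\<lambda>w. w\<^sup>2 / 2) ` {0<..}"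
      by (intro image_eqI[of _ _ "sqrt (2 * t)"]) auto
  qed auto
  have "(f has_integral Gamma r) {0..}"
    unfolding f_def by (rule Gamma_integral_real[OF r])
  then have f: "(f has_integral Gamma r) {0<..}"
    by (subst (asm) has_integral_spike_set_eq[of _ "{0<..}"])
      (auto intro!: negligible_subset[OF negligible_sing[of 0]])
  have "f absolutely_integrable_on {0<..} \<and> integral {0<..} f = Gamma r"
    using f by (auto simp: f_def intro!: nonnegative_absolutely_integrable_1 integral_unique)
  then have "(\<lambda>w. \<bar>w\<bar> * f (w\<^sup>2 / 2)) absolutely_integrable_on {0<..} \<and>
      integral {0<..} (\<lambda>w. \<bar>w\<bar> * f (w\<^sup>2 / 2)) = Gamma r"
    by (subst has_absolute_integral_change_of_variables_1'[where g="\<lambda>w. w\<^sup>2 / 2"])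
      (auto simp: img inj_on_def intro!: derivative_eq_intros)
  then have "(h has_integral Gamma r) {0<..}"
    unfolding h_def[abs_def] by (auto simp: has_integral_iff set_lebesgue_integral_eq_integral)
  then have nn: "(\<integral>\<^sup>+w. ennreal (indicator {0<..} w * h w) \<partial>lborel) = ennreal (Gamma r)"
  proof (rule nn_integral_has_integral_lebesgue[rotated])
    show "0 \<le> h w" for w
      by (simp add: h_def f_def)
  qed
  have "indicator {0<..} w * (w powr s * exp (- w\<^sup>2 / 2)) = 2 powr (r - 1) * (indicator {0<..} w * h w)" for w :: real
  proof (cases "0 < w")
    case True
    have "2 powr (r - 1) * (w\<^sup>2 / 2) powr (r - 1) = (w\<^sup>2) powr (r - 1)"
      using True by (simp add: powr_mult[symmetric])
    also have "\<dots> = w powr (2 * (r - 1))"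
      using True by (simp add: powr_powr flip: powr_numeral)
    also have "w * \<dots> = w powr s"
    proof -
      have "s = 1 + 2 * (r - 1)"
        by (simp add: r_def field_simps)
      then show ?thesis
        using True powr_add[of w 1 "2 * (r - 1)"] by simp
    qed
    finally show ?thesis
      using True by (simp add: h_def f_def exp_minus field_simps)
  qed simp
  then have "(\<integral>\<^sup>+w. ennreal (indicator {0<..} w * (w powr s * exp (- w\<^sup>2 / 2))) \<partial>lborel)
      = (\<integral>\<^sup>+w. ennreal (2 powr (r - 1)) * ennreal (indicator {0<..} w * h w) \<partial>lborel)"
    by (intro nn_integral_cong) (simp only:, rule ennreal_mult', simp)
  also have "\<dots> = ennreal (2 powr (r - 1)) * ennreal (Gamma r)"
    unfolding nn[symmetric] by (rule nn_integral_cmult) (simp add: h_def f_def)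
  also have "\<dots> = ennreal (2 powr (r - 1) * Gamma r)"
    by (rule ennreal_mult'[symmetric]) simp
  also have "r - 1 = (s - 1) / 2"
    by (simp add: r_def field_simps)
  finally show ?thesis
    by (simp only: r_def)
qed

lemma cosh_even_sums: "(\<lambda>k. x ^ (2 * k) / fact (2 * k)) sums cosh (x::real)"
proof -
  have "(\<lambda>k. (\<lambda>n. if even n then x ^ n / fact n else 0) (2 * k)) sums cosh x"
    using cosh_converges[of x]
    by (subst sums_mono_reindex) (auto simp: strict_mono_def divide_inverse mult.commute elim!: evenE cong: if_cong)
  then show ?thesis
    by simp
qed

lemma nn_integral_reflect_fold:
  fixes f :: "real \<Rightarrow> ennreal"
  assumes [measurable]: "f \<in> borel_measurable borel"
  shows "(\<integral>\<^sup>+w. f w \<partial>lborel) = (\<integral>\<^sup>+w. indicator {0<..} w * (f w + f (- w)) \<partial>lborel)"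
proof -
  have "AE w in lborel. w \<noteq> (0::real)"
    by (rule AE_lborel_singleton)
  then have "(\<integral>\<^sup>+w. f w \<partial>lborel) = (\<integral>\<^sup>+w. indicator {0<..} w * f w + indicator {..<0} w * f w \<partial>lborel)"
    by (intro nn_integral_cong_AE) (auto elim!: eventually_mono simp: indicator_def)
  also have "\<dots> = (\<integral>\<^sup>+w. indicator {0<..} w * f w \<partial>lborel) + (\<integral>\<^sup>+w. indicator {..<0} w * f w \<partial>lborel)"
    by (rule nn_integral_add) auto
  also have "(\<integral>\<^sup>+w. indicator {..<0} w * f w \<partial>lborel) = (\<integral>\<^sup>+w. indicator {0<..} w * f (- w) \<partial>lborel)"
    by (subst nn_integral_real_affine[where c="-1" and t=0])
      (auto simp: indicator_def intro!: nn_integral_cong)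
  also have "(\<integral>\<^sup>+w. indicator {0<..} w * f w \<partial>lborel) + \<dots>
      = (\<integral>\<^sup>+w. indicator {0<..} w * f w + indicator {0<..} w * f (- w) \<partial>lborel)"
    by (rule nn_integral_add[symmetric]) auto
  finally show ?thesis
    by (simp add: distrib_left)
qed

text \<open>Folding the density of z + c onto w > 0 gives K exp(-w^2/2) cosh(cw). All terms of the
  even cosh series are nonnegative, so it may be integrated termwise. The k-th term contributes
  Gamma(a + k) = (a)_k Gamma(a), which builds M(a, 1/2, c^2/2) exp(-c^2/2); Kummer's transformation
  brings it to the stated form.\<close>

lemma abs_moment_shifted_std_normal:
  fixes c p :: real
  assumes p: "0 < p"
  shows "has_bochner_integral std_normal_distribution (\<lambda>z. \<bar>z + c\<bar> powr p)
    (2 powr (p / 2) * (Gamma (1/2 + p / 2) / Gamma (1/2)) * kummerM (- p / 2) (1/2) (- (c\<^sup>2 / 2)))"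
proof (rule has_bochner_integral_nn_integral)
  define a where "a = 1/2 + p / 2"
  define x where "x = c\<^sup>2 / 2"
  define K where "K = 2 / sqrt (2 * pi) * exp (- x)"
  define G where "G = 2 powr ((p - 1) / 2) * Gamma a"
  have a: "0 < a" using p by (simp add: a_def)
  have KG: "0 \<le> K" "0 \<le> G"
    using a by (auto simp: K_def G_def Gamma_real_nonneg)
  let ?m = "\<lambda>k. pochhammer a k / (pochhammer (1/2) k * fact k) * x ^ k"
  let ?t = "\<lambda>k w. indicator {0<..} w * (w powr p * exp (- w\<^sup>2 / 2) * ((c * w) ^ (2 * k) / fact (2 * k)))"
  have dens: "std_normal_density (w - c) + std_normal_density (- w - c) = K * (exp (- w\<^sup>2 / 2) * cosh (c * w))" for w
    by (simp add: std_normal_density_def K_def x_def cosh_def power2_eq_square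
        diff_divide_distrib add_divide_distrib algebra_simps flip: exp_add)
  have moments: "(\<integral>\<^sup>+w. ennreal (?t k w) \<partial>lborel) = ennreal (G * ?m k)" for k
  proof -
    have "?t k w = c ^ (2 * k) / fact (2 * k) * (indicator {0<..} w * (w powr (p + 2 * real k) * exp (- w\<^sup>2 / 2)))" for w
    proof (cases "0 < w")
      case True
      have "w powr (p + 2 * real k) = w powr p * w ^ (2 * k)"
        using True by (simp add: powr_add powr_realpow[symmetric])
      then show ?thesis
        using True by (simp add: power_mult_distrib)
    qed simp
    then have "(\<integral>\<^sup>+w. ennreal (?t k w) \<partial>lborel)
        = (\<integral>\<^sup>+w. ennreal (c ^ (2 * k) / fact (2 * k)) *
            ennreal (indicator {0<..} w * (w powr (p + 2 * real k) * exp (- w\<^sup>2 / 2))) \<partial>lborel)"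
      by (intro nn_integral_cong) (simp only:, rule ennreal_mult', simp)
    also have "\<dots> = ennreal (c ^ (2 * k) / fact (2 * k)) *
        ennreal (2 powr ((p + 2 * real k - 1) / 2) * Gamma ((p + 2 * real k + 1) / 2))"
      using p nn_integral_half_gaussian_moment[of "p + 2 * real k"] by (subst nn_integral_cmult) simp_all
    also have "\<dots> = ennreal (c ^ (2 * k) / fact (2 * k) * (2 powr ((p + 2 * real k - 1) / 2) * Gamma ((p + 2 * real k + 1) / 2)))"
      by (rule ennreal_mult'[symmetric]) simp
    also have "c ^ (2 * k) / fact (2 * k) * (2 powr ((p + 2 * real k - 1) / 2) * Gamma ((p + 2 * real k + 1) / 2)) = G * ?m k"
    proof -
      have arg: "(p + 2 * real k + 1) / 2 = a + real k"
        by (simp add: a_def field_simps)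
      have "a \<notin> \<int>\<^sub>\<le>\<^sub>0"
        using a by (auto elim!: nonpos_Ints_cases)
      then have Gamma_arg: "Gamma ((p + 2 * real k + 1) / 2) = pochhammer a k * Gamma a"
        unfolding arg using pochhammer_Gamma[of a k] Gamma_real_pos[OF a] by simp
      have arg': "(p + 2 * real k - 1) / 2 = (p - 1) / 2 + real k"
        by (simp add: field_simps)
      have powr_arg: "(2::real) powr ((p + 2 * real k - 1) / 2) = 2 powr ((p - 1) / 2) * 2 ^ k"
        unfolding arg' by (simp add: powr_add powr_realpow)
      \<comment> \<open>2^(2k) in the denominator comes from \<open>fact_double\<close>, which also
        supplies the rising factorial of 1/2; the factor 2^k comes from the Gaussian moment.\<close>
      have cx: "c ^ (2 * k) / 2 ^ (2 * k) * 2 ^ k = x ^ k"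
      proof -
        have "x = c\<^sup>2 / 2\<^sup>2 * 2"
          by (simp add: x_def)
        then show ?thesis
          unfolding power_mult power_divide[symmetric] power_mult_distrib[symmetric] by simp
      qed
      have rearrange: "u / (v * q * r) * (w * y * (z * t)) = (u / v * y) * (w * t) * (z / (q * r))"
        for u v q r w y z t :: real
        by (simp add: mult_ac)
      show ?thesis
        unfolding Gamma_arg powr_arg fact_double rearrange cx G_def by simp
    qed
    finally show ?thesis .
  qed
  have "summable ?m"
    using summable_kummer[of "1/2" a x] by (rule summable_norm_cancel) simp
  then have "?m sums kummerM a (1/2) x"
    unfolding kummerM_def by (rule summable_sums)
  then have sums: "(\<lambda>k. G * ?m k) sums (G * kummerM a (1/2) x)"
    by (rule sums_mult)
  have m0: "0 \<le> ?m k" for k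
    using a pochhammer_pos[of a k] pochhammer_pos[of "1/2 :: real" k] by (simp add: x_def)
  have val: "K * (G * kummerM a (1/2) x)
      = 2 powr (p / 2) * (Gamma (1/2 + p / 2) / Gamma (1/2)) * kummerM (- p / 2) (1/2) (- (c\<^sup>2 / 2))"
  proof -
    have k: "kummerM a (1/2) x * exp (- x) = kummerM (- p / 2) (1/2) (- (c\<^sup>2 / 2))"
      using kummer_transformation[of "1/2" a x] by (simp add: a_def x_def)
    have "(2::real) powr (p / 2) = 2 powr ((p - 1) / 2) * 2 powr (1/2)"
      by (subst powr_add[symmetric]) (simp add: field_simps)
    then have c: "2 / sqrt (2 * pi) * 2 powr ((p - 1) / 2) = 2 powr (p / 2) / sqrt pi"
      by (simp add: real_sqrt_mult powr_half_sqrt field_simps flip: power2_eq_square)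
    have "K * (G * kummerM a (1/2) x)
        = (2 / sqrt (2 * pi) * 2 powr ((p - 1) / 2)) * Gamma a * (kummerM a (1/2) x * exp (- x))"
      by (simp add: K_def G_def)
    then show ?thesis
      unfolding k c by (simp add: a_def Gamma_one_half_real)
  qed
  have G0: "0 \<le> G * kummerM a (1/2) x"
    by (rule sums_le[OF _ sums_zero sums]) (intro mult_nonneg_nonneg KG m0)
  have "(\<integral>\<^sup>+z. ennreal (\<bar>z + c\<bar> powr p) \<partial>std_normal_distribution)
      = (\<integral>\<^sup>+z. ennreal (std_normal_density z * \<bar>z + c\<bar> powr p) \<partial>lborel)"
    by (subst nn_integral_density) (auto simp: ennreal_mult')
  also have "\<dots> = (\<integral>\<^sup>+w. ennreal (std_normal_density (w - c) * \<bar>w\<bar> powr p) \<partial>lborel)"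
    by (subst nn_integral_real_affine[where c=1 and t="-c"]) auto
  also have "\<dots> = (\<integral>\<^sup>+w. indicator {0<..} w * (ennreal (std_normal_density (w - c) * \<bar>w\<bar> powr p)
      + ennreal (std_normal_density (- w - c) * \<bar>- w\<bar> powr p)) \<partial>lborel)"
    by (rule nn_integral_reflect_fold) simp
  also have "\<dots> = (\<integral>\<^sup>+w. ennreal K * (\<Sum>k. ennreal (?t k w)) \<partial>lborel)"
  proof (intro nn_integral_cong)
    fix w :: real
    have "(\<lambda>k. ?t k w) sums (indicator {0<..} w * (w powr p * exp (- w\<^sup>2 / 2) * cosh (c * w)))"
      by (intro sums_mult cosh_even_sums)
    then have "(\<Sum>k. ennreal (?t k w)) = ennreal (indicator {0<..} w * (w powr p * exp (- w\<^sup>2 / 2) * cosh (c * w)))"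
      by (intro suminf_ennreal_eq) (auto intro!: mult_nonneg_nonneg zero_le_even_power)
    moreover have "ennreal (std_normal_density (w - c) * w powr p) + ennreal (std_normal_density (- w - c) * w powr p)
        = ennreal (K * (w powr p * exp (- w\<^sup>2 / 2) * cosh (c * w)))"
    proof -
      have "std_normal_density (w - c) * w powr p + std_normal_density (- w - c) * w powr p
          = K * (exp (- w\<^sup>2 / 2) * cosh (c * w)) * w powr p"
        unfolding dens[symmetric] by (rule distrib_right[symmetric])
      then show ?thesis
        by (simp add: mult_ac flip: ennreal_plus)
    qed
    ultimately show "indicator {0<..} w * (ennreal (std_normal_density (w - c) * \<bar>w\<bar> powr p)
      + ennreal (std_normal_density (- w - c) * \<bar>- w\<bar> powr p)) = ennreal K * (\<Sum>k. ennreal (?t k w))"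
      using KG by (auto simp: indicator_def ennreal_mult')
  qed
  also have "\<dots> = ennreal K * (\<integral>\<^sup>+w. (\<Sum>k. ennreal (?t k w)) \<partial>lborel)"
    by (rule nn_integral_cmult) measurable
  also have "(\<integral>\<^sup>+w. (\<Sum>k. ennreal (?t k w)) \<partial>lborel) = (\<Sum>k. ennreal (G * ?m k))"
    unfolding moments[symmetric] by (rule nn_integral_suminf) measurable
  also have "\<dots> = ennreal (G * kummerM a (1/2) x)"
    by (rule suminf_ennreal_eq[OF _ sums]) (intro mult_nonneg_nonneg KG m0)
  finally show "(\<integral>\<^sup>+z. ennreal (\<bar>z + c\<bar> powr p) \<partial>std_normal_distribution)
      = ennreal (2 powr (p / 2) * (Gamma (1/2 + p / 2) / Gamma (1/2)) * kummerM (- p / 2) (1/2) (- (c\<^sup>2 / 2)))"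
    using KG by (simp add: val flip: ennreal_mult')
  show "0 \<le> 2 powr (p / 2) * (Gamma (1/2 + p / 2) / Gamma (1/2)) * kummerM (- p / 2) (1/2) (- (c\<^sup>2 / 2))"
    unfolding val[symmetric] using KG G0 by simp
qed auto

subsection \<open>The limit law\<close>

lemma power_over_fact_le_exp:
  fixes x :: real
  assumes "0 \<le> x"
  shows "x ^ n / fact n \<le> exp x"
proof -
  have "(\<Sum>k\<in>{n}. x ^ k /\<^sub>R fact k) \<le> (\<Sum>k. x ^ k /\<^sub>R fact k)"
    using assms by (intro sum_le_suminf summable_exp_generic) auto
  then show ?thesis
    by (simp add: exp_def divide_inverse mult.commute)
qed

text \<open>Exponential moments make the characteristic function of \<open>s\<^sup>2\<close> equal to its Taylor series;
  \<open>s\<close> is recovered from \<open>s\<^sup>2\<close> by positivity.\<close>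

lemma real_distribution_eqI_powr_moments:
  fixes \<mu> \<nu> :: "real measure"
  assumes \<mu>: "real_distribution \<mu>" "measure \<mu> {0<..} = 1" "\<And>q. 0 < q \<Longrightarrow> integrable \<mu> (\<lambda>s. s powr q)"
    and \<nu>: "real_distribution \<nu>" "measure \<nu> {0<..} = 1" "\<And>q. 0 < q \<Longrightarrow> integrable \<nu> (\<lambda>s. s powr q)"
    and eq: "\<And>q. 0 < q \<Longrightarrow> (\<integral>s. s powr q \<partial>\<nu>) = (\<integral>s. s powr q \<partial>\<mu>)"
    and exp: "\<And>a. integrable \<mu> (\<lambda>s. exp (a * s\<^sup>2))"
  shows "\<nu> = \<mu>"
proof -
  define m where "m n = (\<integral>s. (s\<^sup>2) ^ n \<partial>\<mu>)" for n :: nat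
  have pos: "AE s in M. 0 < s" if "real_distribution M" "measure M {0<..} = 1" for M :: "real measure"
  proof -
    interpret real_distribution M by fact
    show ?thesis
      using AE_prob_1[of "{0<..}"] that(2) by simp
  qed
  have moments: "integrable M (\<lambda>s. (s\<^sup>2) ^ n) \<and> (\<integral>s. (s\<^sup>2) ^ n \<partial>M) = m n"
    if M: "real_distribution M" "measure M {0<..} = 1" "\<And>q. 0 < q \<Longrightarrow> integrable M (\<lambda>s. s powr q)"
      and eqM: "\<And>q. 0 < q \<Longrightarrow> (\<integral>s. s powr q \<partial>M) = (\<integral>s. s powr q \<partial>\<mu>)" for M n
  proof (cases "n = 0")
    \<comment> \<open>The hypotheses speak of q > 0 only; the moment of order 0 is the total
      mass.\<close>
    case True
    interpret M: real_distribution M by fact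
    interpret \<mu>: real_distribution \<mu> by fact
    show ?thesis
      using M.prob_space \<mu>.prob_space True by (simp add: m_def)
  next
    case False
    have AE: "AE s in K. (s\<^sup>2) ^ n = s powr real (2 * n)"
      if "real_distribution K" "measure K {0<..} = 1" for K :: "real measure"
      using pos[OF that]
    proof eventually_elim
      case (elim s)
      then show ?case
        using powr_realpow[of s "2 * n"] by (simp add: power_mult)
    qed
    have meas: "f \<in> borel_measurable K" if "real_distribution K" "f \<in> borel_measurable borel"
      for K and f :: "real \<Rightarrow> real"
      using that by (simp add: real_distribution.events_eq_borel cong: measurable_cong_sets)
    have int: "integrable K (\<lambda>s. (s\<^sup>2) ^ n)" "(\<integral>s. (s\<^sup>2) ^ n \<partial>K) = (\<integral>s. s powr real (2 * n) \<partial>K)"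
      if K: "real_distribution K" "measure K {0<..} = 1" "\<And>q. 0 < q \<Longrightarrow> integrable K (\<lambda>s. s powr q)" for K
    proof -
      show "integrable K (\<lambda>s. (s\<^sup>2) ^ n)"
        using K(3)[of "real (2 * n)"] False AE[OF K(1,2)]
        by (subst integrable_cong_AE[where g="\<lambda>s. s powr real (2 * n)"]) (auto intro!: meas[OF K(1)])
      show "(\<integral>s. (s\<^sup>2) ^ n \<partial>K) = (\<integral>s. s powr real (2 * n) \<partial>K)"
        using AE[OF K(1,2)] by (intro integral_cong_AE) (auto intro!: meas[OF K(1)])
    qed
    show ?thesis
      using int[OF M(1,2,3)] int[OF \<mu>] eqM[of "real (2 * n)"] False by (simp add: m_def)
  qed
  have char_tendsto: "(\<lambda>n. \<Sum>k\<le>n. ((\<i> * t) ^ k / fact k) * m k) \<longlonglongrightarrow> char (distr M borel (\<lambda>s. s\<^sup>2)) t"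
    if M: "real_distribution M" "measure M {0<..} = 1" "\<And>q. 0 < q \<Longrightarrow> integrable M (\<lambda>s. s powr q)"
      and eqM: "\<And>q. 0 < q \<Longrightarrow> (\<integral>s. s powr q \<partial>M) = (\<integral>s. s powr q \<partial>\<mu>)" for M t
  proof -
    interpret M: real_distribution M by fact
    note mom = moments[OF M eqM]
    \<comment> \<open>The Taylor remainder is 2 |t|^n m_n / n!. Doubling |t| in the exponent splits
      off (1/2)^n. The remainder involves only the common moments, so exponential moments of \<mu>
      control both laws.\<close>
    define C where "C = (\<integral>s. exp (2 * \<bar>t\<bar> * s\<^sup>2) \<partial>\<mu>)"
    have "cmod (char (distr M borel (\<lambda>s. s\<^sup>2)) t - (\<Sum>k\<le>n. ((\<i> * t) ^ k / fact k) * m k)) \<le> 2 * C * (1/2) ^ n" for n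
    proof -
      have "cmod (char (distr M borel (\<lambda>s. s\<^sup>2)) t - (\<Sum>k\<le>n. ((\<i> * t) ^ k / fact k) * (\<integral>s. (s\<^sup>2) ^ k \<partial>M)))
          \<le> (2 * \<bar>t\<bar> ^ n / fact n) * (\<integral>s. \<bar>s\<^sup>2\<bar> ^ n \<partial>M)"
        using mom by (intro M.char_approx1') auto
      then have "cmod (char (distr M borel (\<lambda>s. s\<^sup>2)) t - (\<Sum>k\<le>n. ((\<i> * t) ^ k / fact k) * m k))
          \<le> (2 * \<bar>t\<bar> ^ n / fact n) * m n"
        using mom by simp
      also have "\<dots> = 2 * (1/2) ^ n * ((2 * \<bar>t\<bar>) ^ n / fact n * m n)"
        by (simp add: power_mult_distrib power_divide)
      also have "(2 * \<bar>t\<bar>) ^ n / fact n * m n = (\<integral>s. (2 * \<bar>t\<bar>) ^ n / fact n * (s\<^sup>2) ^ n \<partial>\<mu>)"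
        by (simp add: m_def)
      also have "\<dots> \<le> C"
        unfolding C_def
      proof (rule integral_mono)
        show "integrable \<mu> (\<lambda>s. (2 * \<bar>t\<bar>) ^ n / fact n * (s\<^sup>2) ^ n)"
          using moments[OF \<mu> refl, of n] by auto
        show "(2 * \<bar>t\<bar>) ^ n / fact n * (s\<^sup>2) ^ n \<le> exp (2 * \<bar>t\<bar> * s\<^sup>2)" for s
          using power_over_fact_le_exp[of "2 * \<bar>t\<bar> * s\<^sup>2" n] by (simp add: power_mult_distrib)
      qed (rule exp)
      finally show ?thesis
        by (simp add: mult_ac)
    qed
    then have bound: "eventually (\<lambda>n. cmod ((\<Sum>k\<le>n. ((\<i> * t) ^ k / fact k) * m k) - char (distr M borel (\<lambda>s. s\<^sup>2)) t)
        \<le> 2 * C * (1/2) ^ n) sequentially"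
      by (simp add: norm_minus_commute)
    have "(\<lambda>n. 2 * C * (1/2) ^ n) \<longlonglongrightarrow> 0"
      by (intro tendsto_mult_right_zero LIMSEQ_realpow_zero) auto
    from Lim_null_comparison[OF bound this] show ?thesis
      by (rule LIM_zero_cancel)
  qed
  have sq: "real_distribution (distr M borel (\<lambda>s. s\<^sup>2))" if "real_distribution M" for M :: "real measure"
  proof -
    interpret real_distribution M by fact
    show ?thesis
      by (rule real_distribution_distr) simp
  qed
  have "distr \<nu> borel (\<lambda>s. s\<^sup>2) = distr \<mu> borel (\<lambda>s. s\<^sup>2)"
    using LIMSEQ_unique[OF char_tendsto[OF \<nu> eq] char_tendsto[OF \<mu> refl]]
    by (intro Levy_uniqueness sq \<mu>(1) \<nu>(1)) auto
  moreover have "distr (distr M borel (\<lambda>s. s\<^sup>2)) borel sqrt = M"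
    if M: "real_distribution M" "measure M {0<..} = 1" for M :: "real measure"
  proof -
    interpret M: real_distribution M by fact
    have "distr (distr M borel (\<lambda>s. s\<^sup>2)) borel sqrt = distr M borel (\<lambda>s. sqrt (s\<^sup>2))"
      by (subst distr_distr) (auto simp: comp_def)
    also have "\<dots> = distr M M (\<lambda>s. s)"
      using pos[OF M] by (intro distr_cong_AE) (auto elim: eventually_mono)
    finally show ?thesis
      by simp
  qed
  ultimately show ?thesis
    using \<mu> \<nu> by metis
qed

lemma integrable_exp_std_normal: "integrable std_normal_distribution (\<lambda>z. exp (b * z))"
proof -
  have "std_normal_density z * exp (b * z) = exp (b\<^sup>2 / 2) * normal_density b 1 z" for z
    by (simp add: normal_density_def power2_eq_square algebra_simps diff_divide_distrib add_divide_distrib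
        flip: exp_add)
  then show ?thesis
    by (subst integrable_density) (auto intro!: integrable_normal_density)
qed

definition limit_law :: "real \<Rightarrow> real \<Rightarrow> real measure" where
  "limit_law \<sigma> m = distr std_normal_distribution borel (\<lambda>z. sqrt \<bar>\<sigma> * z + m\<bar>)"

lemma real_distribution_limit_law: "real_distribution (limit_law \<sigma> m)"
proof -
  interpret prob_space std_normal_distribution
    by (rule prob_space_normal_density) simp
  show ?thesis
    unfolding limit_law_def by (rule real_distribution_distr) simp
qed

lemma limit_law_positive:
  assumes "0 < \<sigma>"
  shows "measure (limit_law \<sigma> m) {0<..} = 1"
proof -
  interpret real_distribution "limit_law \<sigma> m"
    by (rule real_distribution_limit_law)
  have "AE z in lborel. z \<noteq> - m / \<sigma>"
    by (rule AE_lborel_singleton)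
  then have "AE z in lborel. 0 < ennreal (std_normal_density z) \<longrightarrow> 0 < \<bar>\<sigma> * z + m\<bar>"
    by eventually_elim (use assms in \<open>auto simp: field_simps add_eq_0_iff\<close>)
  then have "AE s in limit_law \<sigma> m. s \<in> {0<..}"
    unfolding limit_law_def by (subst AE_distr_iff) (auto simp: AE_density)
  then show ?thesis
    by (subst prob_eq_1) auto
qed

text \<open>Under this law s^2 is the modulus of an affine function of a normal variable, so the
  exponent grows only linearly; use exp|y| <= exp(y) + exp(-y).\<close>

lemma limit_law_exp_integrable: "integrable (limit_law \<sigma> m) (\<lambda>s. exp (a * s\<^sup>2))"
proof -
  define b where "b = \<bar>a\<bar> * \<sigma>"
  have "integrable std_normal_distribution (\<lambda>z. exp (\<bar>a\<bar> * \<bar>m\<bar>) * (exp (b * z) + exp (- b * z)))"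
    using integrable_exp_std_normal[of b] integrable_exp_std_normal[of "- b"] by simp
  then have "integrable std_normal_distribution (\<lambda>z. exp (a * \<bar>\<sigma> * z + m\<bar>))"
  proof (rule Bochner_Integration.integrable_bound)
    have "exp (a * \<bar>\<sigma> * z + m\<bar>) \<le> exp (\<bar>a\<bar> * \<bar>m\<bar>) * (exp (b * z) + exp (- b * z))" for z
    proof -
      have "a * \<bar>\<sigma> * z + m\<bar> \<le> \<bar>a\<bar> * (\<bar>\<sigma> * z\<bar> + \<bar>m\<bar>)"
        by (intro mult_mono) auto
      also have "\<dots> = \<bar>a\<bar> * \<bar>m\<bar> + \<bar>b * z\<bar>"
        by (simp add: b_def abs_mult algebra_simps)
      finally have "exp (a * \<bar>\<sigma> * z + m\<bar>) \<le> exp (\<bar>a\<bar> * \<bar>m\<bar>) * exp \<bar>b * z\<bar>"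
        by (simp flip: exp_add)
      also have "\<dots> \<le> exp (\<bar>a\<bar> * \<bar>m\<bar>) * (exp (b * z) + exp (- b * z))"
        by (intro mult_left_mono) (auto simp: abs_if)
      finally show ?thesis .
    qed
    then show "AE z in std_normal_distribution.
        norm (exp (a * \<bar>\<sigma> * z + m\<bar>)) \<le> norm (exp (\<bar>a\<bar> * \<bar>m\<bar>) * (exp (b * z) + exp (- b * z)))"
      by (auto simp: abs_mult)
  qed simp
  then show ?thesis
    unfolding limit_law_def by (subst integrable_distr_eq) auto
qed

text \<open>Scaling out \<sigma> leaves the shift c = T z_0 / \<sigma> with c^2/2 = 3 z_0^2/(2T):
  this is the -3x in \<open>hfun\<close>. The square root makes the exponent p = q/2, and -p/2 =
  -q/4 is -\<rho>/3 for \<rho> = 3q/4.\<close>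

lemma limit_law_moment:
  assumes T: "0 < T" and q: "0 < q"
  shows "has_bochner_integral (limit_law (sqrt (T ^ 3 / 3)) (T * z0)) (\<lambda>s. s powr q)
    ((2/3) powr (q/4) * (Gamma (1/2 + q/4) / Gamma (1/2)) * T powr (3*q/4) * hfun (3*q/4) (z0\<^sup>2 / (2*T)))"
proof -
  define \<sigma> where "\<sigma> = sqrt (T ^ 3 / 3)"
  define c where "c = T * z0 / \<sigma>"
  have \<sigma>: "0 < \<sigma>" "\<sigma>\<^sup>2 = T ^ 3 / 3"
    using T by (simp_all add: \<sigma>_def)
  have integrand: "sqrt \<bar>\<sigma> * z + T * z0\<bar> powr q = \<sigma> powr (q/2) * \<bar>z + c\<bar> powr (q/2)" for z
  proof -
    have "\<sigma> * z + T * z0 = \<sigma> * (z + c)"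
      using \<sigma> by (simp add: c_def field_simps)
    then have "\<bar>\<sigma> * z + T * z0\<bar> = \<sigma> * \<bar>z + c\<bar>"
      using \<sigma> by (simp add: abs_mult)
    then show ?thesis
      using \<sigma> by (simp add: powr_half_sqrt[symmetric] powr_powr powr_mult)
  qed
  have moment: "has_bochner_integral std_normal_distribution (\<lambda>z. sqrt \<bar>\<sigma> * z + T * z0\<bar> powr q)
      (\<sigma> powr (q/2) * (2 powr (q/2/2) * (Gamma (1/2 + q/2/2) / Gamma (1/2)) * kummerM (- (q/2)/2) (1/2) (- (c\<^sup>2/2))))"
    unfolding integrand using q
    by (intro has_bochner_integral_mult_right abs_moment_shifted_std_normal) auto
  have "\<sigma> powr (q/2) * 2 powr (q/4) = (\<sigma>\<^sup>2) powr (q/4) * 2 powr (q/4)"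
    using \<sigma>(1) by (simp add: powr_powr flip: powr_numeral)
  also have "\<dots> = (2/3 * T ^ 3) powr (q/4)"
    unfolding \<sigma> using T by (subst powr_mult[symmetric]) (auto simp: mult_ac)
  also have "\<dots> = (2/3) powr (q/4) * T powr (3*q/4)"
    using T by (subst powr_mult) (auto simp: powr_powr simp flip: powr_numeral)
  finally have scale: "\<sigma> powr (q/2) * 2 powr (q/4) = (2/3) powr (q/4) * T powr (3*q/4)" .
  have "c\<^sup>2 = (T * z0)\<^sup>2 / (T ^ 3 / 3)"
    by (simp only: c_def power_divide \<sigma>(2))
  then have arg: "- (c\<^sup>2 / 2) = - 3 * (z0\<^sup>2 / (2*T))"
    using T by (simp add: power2_eq_square power3_eq_cube field_simps)
  have kummer: "kummerM (- (q/2)/2) (1/2) (- (c\<^sup>2/2)) = hfun (3*q/4) (z0\<^sup>2 / (2*T))"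
    unfolding hfun_def arg by simp
  have val: "\<sigma> powr (q/2) * (2 powr (q/2/2) * (Gamma (1/2 + q/2/2) / Gamma (1/2)) * kummerM (- (q/2)/2) (1/2) (- (c\<^sup>2/2)))
      = (2/3) powr (q/4) * (Gamma (1/2 + q/4) / Gamma (1/2)) * T powr (3*q/4) * hfun (3*q/4) (z0\<^sup>2 / (2*T))"
    using scale unfolding kummer by (simp add: mult_ac)
  show ?thesis
    using moment unfolding val limit_law_def \<sigma>_def[symmetric]
    by (subst has_bochner_integral_distr) (auto simp: has_bochner_integral_iff)
qed

subsection \<open>Convergence in distribution\<close>

lemma sum_squares_descending:
  "(\<Sum>j<n. (real n - real j)\<^sup>2) = real n * (real n + 1) * (2 * real n + 1) / 6"
proof -
  have "(\<Sum>j<n. (real n - real j)\<^sup>2) = (\<Sum>j<n. (real (Suc j))\<^sup>2)"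
    by (subst sum.nat_diff_reindex[symmetric]) (auto intro!: sum.cong simp: of_nat_diff)
  also have "\<dots> = real n * (real n + 1) * (2 * real n + 1) / 6"
    by (induction n) (auto simp: power2_eq_square field_simps)
  finally show ?thesis .
qed

lemma cmod_iexp_diff_le: "cmod (iexp a - iexp b) \<le> \<bar>a - b\<bar>"
proof -
  have "iexp a - iexp b = iexp b * (iexp (a - b) - 1)"
    by (simp add: algebra_simps flip: exp_add)
  then have "cmod (iexp a - iexp b) = cmod (iexp (a - b) - 1)"
    by (simp add: norm_mult)
  also have "\<dots> \<le> \<bar>a - b\<bar>"
    using iexp_approx1[of "a - b" 0] by simp
  finally show ?thesis .
qed

lemma char_affine_std_normal:
  "char (distr std_normal_distribution borel (\<lambda>z. \<sigma> * z + m)) t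
    = complex_of_real (exp (- (t * \<sigma>)\<^sup>2 / 2)) * iexp (t * m)"
proof -
  have "char (distr std_normal_distribution borel (\<lambda>z. \<sigma> * z + m)) t
      = (\<integral>z. iexp (t * (\<sigma> * z + m)) \<partial>std_normal_distribution)"
    unfolding char_def by (subst integral_distr) auto
  also have "\<dots> = (\<integral>z. iexp (t * \<sigma> * z) * iexp (t * m) \<partial>std_normal_distribution)"
    by (intro Bochner_Integration.integral_cong) (auto simp: algebra_simps simp flip: exp_add)
  also have "\<dots> = char std_normal_distribution (t * \<sigma>) * iexp (t * m)"
    unfolding char_def by simp
  finally show ?thesis
    by (simp add: char_std_normal_distribution)
qed

section \<open>Scaling limit from a balanced start\<close>

locale balanced_start = driven_chain M E U
  for M :: "'a measure" and E U :: "nat \<Rightarrow> 'a \<Rightarrow> real" +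
  fixes X0 Y0 :: "nat \<Rightarrow> nat" and T z0 :: real
  assumes T: "0 < T"
    and total: "1 \<le> N \<Longrightarrow> real (X0 N) / real N + real (Y0 N) / real N = T"
    and gap0: "(\<lambda>N. sqrt (real N) * (real (X0 N) / real N - real (Y0 N) / real N)) \<longlonglongrightarrow> z0"
begin

abbreviation start :: "nat \<Rightarrow> nat \<times> nat" where
  "start N \<equiv> (X0 N, Y0 N)"

abbreviation final_gap :: "nat \<Rightarrow> 'a \<Rightarrow> real" where
  "final_gap N \<omega> \<equiv> gap (state (start N) (X0 N + Y0 N) \<omega>) / (real N * sqrt (real N))"

lemma total_eq: "1 \<le> N \<Longrightarrow> real (X0 N + Y0 N) = T * real N"
  using total[of N] by (simp add: field_simps)

lemma start_gap_tendsto: "(\<lambda>N. gap (start N) / (real N * sqrt (real N))) \<longlonglongrightarrow> T * z0"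
proof -
  have lim: "(\<lambda>N. (T + 1 / real N) * (sqrt (real N) * (real (X0 N) / real N - real (Y0 N) / real N))) \<longlonglongrightarrow> (T + 0) * z0"
    by (intro tendsto_mult tendsto_add tendsto_const gap0 lim_1_over_n)
  have eq: "(T + 1 / real N) * (sqrt (real N) * (real (X0 N) / real N - real (Y0 N) / real N))
      = gap (start N) / (real N * sqrt (real N))" if N: "1 \<le> N" for N
  proof -
    have "gap (start N) = (T * real N + 1) * (real (X0 N) - real (Y0 N))"
      using total_eq[OF N] by (simp add: gap_def)
    moreover have "sqrt (real N) * sqrt (real N) = real N"
      by simp
    ultimately show ?thesis
      using N by (simp add: divide_simps)
  qed
  show ?thesis
    using Lim_transform_eventually[OF lim eventually_sequentiallyI[of 1]] eq by simp
qed

lemma final_gap_char_tendsto: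
  "(\<lambda>N. \<integral>\<omega>. iexp (t * final_gap N \<omega>) \<partial>M) 
    \<longlonglongrightarrow> complex_of_real (exp (- (t * sqrt (T ^ 3 / 3))\<^sup>2 / 2)) * iexp (t * (T * z0))"
proof -
  define n where "n N = real (X0 N + Y0 N)" for N
  define \<theta> where "\<theta> N = t / (real N * sqrt (real N))" for N
  define g where "g N = gap (start N) / (real N * sqrt (real N))" for N
  define A where "A N = exp (- (\<theta> N ^ 2 / 2 * (\<Sum>j<X0 N + Y0 N. (n N - real j)\<^sup>2))) * iexp (\<theta> N * gap (start N))" for N
  have g: "g \<longlonglongrightarrow> T * z0"
    unfolding g_def by (rule start_gap_tendsto)
  have bound: "cmod ((\<integral>\<omega>. iexp (t * final_gap N \<omega>) \<partial>M) - A N)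
      \<le> n N * (2 * \<bar>\<theta> N\<bar> ^ 3 * n N ^ 3 + \<theta> N ^ 2 / 2 * sqrt ((gap (start N))\<^sup>2 + n N ^ 3) + (\<theta> N ^ 2 / 2 * (n N)\<^sup>2)\<^sup>2)" for N
    using char_gap[of "X0 N + Y0 N" "start N" "\<theta> N"] by (simp add: n_def A_def \<theta>_def)
  have bound': "eventually (\<lambda>N. cmod ((\<integral>\<omega>. iexp (t * final_gap N \<omega>) \<partial>M) - A N)
      \<le> 2 * \<bar>t\<bar> ^ 3 * T ^ 4 * (1 / sqrt (real N)) + t\<^sup>2 / 2 * T * sqrt ((g N)\<^sup>2 + T ^ 3) * (1 / sqrt (real N))
        + t ^ 4 / 4 * T ^ 5 * (1 / real N)) sequentially"
  proof (rule eventually_sequentiallyI[of 1])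
    fix N :: nat assume N: "1 \<le> N"
    \<comment> \<open>With N = r^2 all scales become integer powers of r.\<close>
    define r where "r = sqrt (real N)"
    have r: "0 < r" "real N = r\<^sup>2"
      using N by (simp_all add: r_def)
    have n: "n N = T * r\<^sup>2"
      using total_eq[OF N] r by (simp add: n_def)
    have scale: "real N * sqrt (real N) = r ^ 3"
      unfolding r_def[symmetric] unfolding r(2) by (simp add: power3_eq_cube power2_eq_square)
    have th: "\<theta> N = t / r ^ 3"
      by (simp only: \<theta>_def scale)
    have gap: "gap (start N) = g N * r ^ 3"
      using r(1) by (simp add: g_def scale)
    have "(gap (start N))\<^sup>2 + n N ^ 3 = ((g N)\<^sup>2 + T ^ 3) * (r ^ 3)\<^sup>2"
      by (simp add: gap n power_mult_distrib algebra_simps flip: power_mult)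
    then have sq: "sqrt ((gap (start N))\<^sup>2 + n N ^ 3) = sqrt ((g N)\<^sup>2 + T ^ 3) * r ^ 3"
      using r(1) by (simp only: real_sqrt_mult real_sqrt_abs) simp
    have "n N * (2 * \<bar>\<theta> N\<bar> ^ 3 * n N ^ 3 + \<theta> N ^ 2 / 2 * sqrt ((gap (start N))\<^sup>2 + n N ^ 3) + (\<theta> N ^ 2 / 2 * (n N)\<^sup>2)\<^sup>2)
        = 2 * \<bar>t\<bar> ^ 3 * T ^ 4 * (1 / r) + t\<^sup>2 / 2 * T * sqrt ((g N)\<^sup>2 + T ^ 3) * (1 / r) + t ^ 4 / 4 * T ^ 5 * (1 / r\<^sup>2)"
      unfolding sq unfolding n th using r(1)
      by (simp add: power_divide power_mult_distrib abs_mult field_simps flip: power_mult)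
        (simp add: field_simps eval_nat_numeral abs_of_pos[OF r(1)])
    moreover have "1 / r = 1 / sqrt (real N)" "1 / r\<^sup>2 = 1 / real N"
      by (simp_all add: r_def)
    ultimately show "cmod ((\<integral>\<omega>. iexp (t * final_gap N \<omega>) \<partial>M) - A N)
      \<le> 2 * \<bar>t\<bar> ^ 3 * T ^ 4 * (1 / sqrt (real N)) + t\<^sup>2 / 2 * T * sqrt ((g N)\<^sup>2 + T ^ 3) * (1 / sqrt (real N))
        + t ^ 4 / 4 * T ^ 5 * (1 / real N)"
      using bound[of N] by (simp only:)
  qed
  have inv_sqrt: "(\<lambda>N. 1 / sqrt (real N)) \<longlonglongrightarrow> 0"
    by real_asymp
  have "(\<lambda>N. 2 * \<bar>t\<bar> ^ 3 * T ^ 4 * (1 / sqrt (real N)) + t\<^sup>2 / 2 * T * sqrt ((g N)\<^sup>2 + T ^ 3) * (1 / sqrt (real N))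
        + t ^ 4 / 4 * T ^ 5 * (1 / real N)) \<longlonglongrightarrow>
      2 * \<bar>t\<bar> ^ 3 * T ^ 4 * 0 + t\<^sup>2 / 2 * T * sqrt ((T * z0)\<^sup>2 + T ^ 3) * 0 + t ^ 4 / 4 * T ^ 5 * 0"
    by (intro tendsto_intros inv_sqrt g lim_1_over_n)
  then have "(\<lambda>N. (\<integral>\<omega>. iexp (t * final_gap N \<omega>) \<partial>M) - A N) \<longlonglongrightarrow> 0"
    using Lim_null_comparison[OF bound'] by simp
  moreover have "A \<longlonglongrightarrow> complex_of_real (exp (- (t * sqrt (T ^ 3 / 3))\<^sup>2 / 2)) * iexp (t * (T * z0))"
  proof (rule Lim_transform_eventually)
    have "(\<lambda>N. T * (T + 1 / real N) * (2 * T + 1 / real N) / 6) \<longlonglongrightarrow> T * (T + 0) * (2 * T + 0) / 6"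
      by (intro tendsto_intros lim_1_over_n) simp
    then have "(\<lambda>N. complex_of_real (exp (- (t\<^sup>2 / 2 * (T * (T + 1 / real N) * (2 * T + 1 / real N) / 6)))) * iexp (t * g N))
        \<longlonglongrightarrow> complex_of_real (exp (- (t\<^sup>2 / 2 * (T * (T + 0) * (2 * T + 0) / 6)))) * iexp (t * (T * z0))"
      by (intro tendsto_intros g) simp
    also have "t\<^sup>2 / 2 * (T * (T + 0) * (2 * T + 0) / 6) = (t * sqrt (T ^ 3 / 3))\<^sup>2 / 2"
      using T by (simp add: power_mult_distrib) (simp add: power3_eq_cube)
    finally show "(\<lambda>N. complex_of_real (exp (- (t\<^sup>2 / 2 * (T * (T + 1 / real N) * (2 * T + 1 / real N) / 6)))) * iexp (t * g N))
        \<longlonglongrightarrow> complex_of_real (exp (- (t * sqrt (T ^ 3 / 3))\<^sup>2 / 2)) * iexp (t * (T * z0))"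
      by (simp only: minus_divide_left)
    show "eventually (\<lambda>N. complex_of_real (exp (- (t\<^sup>2 / 2 * (T * (T + 1 / real N) * (2 * T + 1 / real N) / 6)))) * iexp (t * g N)
        = A N) sequentially"
    proof (rule eventually_sequentiallyI[of 1])
      fix N :: nat assume N: "1 \<le> N"
      have "\<theta> N * gap (start N) = t * g N"
        by (simp add: \<theta>_def g_def)
      moreover have "\<theta> N ^ 2 / 2 * (\<Sum>j<X0 N + Y0 N. (n N - real j)\<^sup>2)
          = t\<^sup>2 / 2 * (T * (T + 1 / real N) * (2 * T + 1 / real N) / 6)"
      proof -
        have \<theta>2: "\<theta> N ^ 2 = t\<^sup>2 / real N ^ 3"
          by (simp add: \<theta>_def power_divide power_mult_distrib power3_eq_cube power2_eq_square)
        show ?thesis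
          using N unfolding \<theta>2 n_def sum_squares_descending unfolding total_eq[OF N]
          by (simp add: field_simps) (simp add: power3_eq_cube power2_eq_square algebra_simps)
      qed
      ultimately show "complex_of_real (exp (- (t\<^sup>2 / 2 * (T * (T + 1 / real N) * (2 * T + 1 / real N) / 6)))) * iexp (t * g N) = A N"
        by (simp only: A_def)
    qed
  qed
  ultimately show ?thesis
    using tendsto_add by fastforce
qed

lemma final_gap_tendsto:
  "weak_conv_m (\<lambda>N. distr M borel (final_gap N))
     (distr std_normal_distribution borel (\<lambda>z. sqrt (T ^ 3 / 3) * z + T * z0))"
proof (rule levy_continuity)
  have [measurable]: "final_gap N \<in> borel_measurable M" for N
    by measurable
  show "real_distribution (distr M borel (final_gap N))" for N
    by (rule real_distribution_distr) simp
  show "real_distribution (distr std_normal_distribution borel (\<lambda>z. sqrt (T ^ 3 / 3) * z + T * z0))"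
    using prob_space.real_distribution_distr[OF prob_space_normal_density[of 1 0]] by simp
  show "(\<lambda>N. char (distr M borel (final_gap N)) t)
      \<longlonglongrightarrow> char (distr std_normal_distribution borel (\<lambda>z. sqrt (T ^ 3 / 3) * z + T * z0)) t" for t
  proof -
    have eq: "char (distr M borel (final_gap N)) t = (\<integral>\<omega>. iexp (t * final_gap N \<omega>) \<partial>M)" for N
      unfolding char_def by (subst integral_distr) auto
    show ?thesis
      unfolding char_affine_std_normal eq by (rule final_gap_char_tendsto)
  qed
qed

abbreviation residual :: "nat \<Rightarrow> 'a \<Rightarrow> real" where
  "residual N \<omega> \<equiv> real N powr (1/4) * (T - ruin_time N (start N) (\<lambda>i. E i \<omega>) (\<lambda>i. U i \<omega>))"

lemma measurable_residual: "residual N \<in> borel_measurable M"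
proof -
  have [measurable]: "(\<lambda>\<omega>. ruin_time N (start N) (\<lambda>i. E i \<omega>) (\<lambda>i. U i \<omega>)) \<in> borel_measurable M"
    by (rule measurable_ruin_time) auto
  show ?thesis
    by measurable
qed

text \<open>With \<open>R\<close> survivors after \<open>l = n - R\<close> jumps, the residual time is \<open>N powr (- 3/4)\<close> times \<open>R\<close>
  minus the clock fluctuation after \<open>l\<close> jumps, and the final gap is \<open>R (R + 1)\<close> up to sign.\<close>

lemma residual_approx:
  assumes N: "1 \<le> N" and pos: "0 < X0 N" "0 < Y0 N"
  defines "l \<omega> \<equiv> X0 N + Y0 N - survivors (start N) (\<lambda>i. U i \<omega>)"
  shows "AE \<omega> in M. \<bar>residual N \<omega> - sqrt \<bar>final_gap N \<omega>\<bar>\<bar>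
    \<le> real N powr (1/4) / real N * (1 + sqrt (real N) + ((\<Sum>i<l \<omega>. E i \<omega>) - real (l \<omega>))\<^sup>2 / sqrt (real N))"
  using AE_E_nonneg AE_clock_unbounded
proof eventually_elim
  case (elim \<omega>)
  define a where "a = real N powr (1/4) / real N"
  define R where "R = real (survivors (start N) (\<lambda>i. U i \<omega>))"
  define x where "x = (\<Sum>i<l \<omega>. E i \<omega>) - real (l \<omega>)"
  have a: "0 \<le> a" by (simp add: a_def)
  have R: "0 \<le> R" by (simp add: R_def)
  have "survivors (start N) (\<lambda>i. U i \<omega>) \<le> X0 N + Y0 N"
    using survivors_le[of "start N" "\<lambda>i. U i \<omega>"] by simp
  then have l: "real (l \<omega>) = T * real N - R"
    unfolding l_def R_def total_eq[OF N, symmetric] by (rule of_nat_diff)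
  have "ruin_time N (start N) (\<lambda>i. E i \<omega>) (\<lambda>i. U i \<omega>) = (\<Sum>i<l \<omega>. E i \<omega>) / real N"
    using ruin_time_eq[of N "start N" "\<lambda>i. E i \<omega>" "\<lambda>i. U i \<omega>"] N pos elim by (simp add: l_def)
  then have residual: "residual N \<omega> = a * (R - x)"
    using N l by (simp add: a_def x_def field_simps)
  have gap: "sqrt \<bar>final_gap N \<omega>\<bar> = a * sqrt (R * (R + 1))"
  proof -
    have "a\<^sup>2 = (real N powr (1/4))\<^sup>2 / (real N)\<^sup>2"
      by (simp add: a_def power_divide)
    also have "(real N powr (1/4))\<^sup>2 = sqrt (real N)"
      using N by (simp add: powr_half_sqrt[symmetric] powr_powr flip: powr_numeral)
    also have "sqrt (real N) / (real N)\<^sup>2 = 1 / (real N * sqrt (real N))"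
      using N by (simp add: power2_eq_square field_simps)
    finally have a2: "a\<^sup>2 = 1 / (real N * sqrt (real N))" .
    have "\<bar>final_gap N \<omega>\<bar> = a\<^sup>2 * (R * (R + 1))"
      using abs_gap_final[of "start N" "\<lambda>i. U i \<omega>"] by (simp add: a2 R_def)
    then show ?thesis
      using a by (simp add: real_sqrt_mult)
  qed
  have "R \<le> sqrt (R * (R + 1))"
    using R by (intro real_le_rsqrt) (simp add: power2_eq_square algebra_simps)
  moreover have "sqrt (R * (R + 1)) \<le> R + 1"
    using R by (intro real_le_lsqrt) (auto simp: power2_eq_square algebra_simps)
  ultimately have "\<bar>R - sqrt (R * (R + 1))\<bar> \<le> 1"
    by linarith
  \<comment> \<open>Trading |x| for x^2, balanced at its typical size sqrt(N), lets the second
    moment of the clock suffice.\<close>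
  moreover have "\<bar>x\<bar> \<le> sqrt (real N) + x\<^sup>2 / sqrt (real N)"
  proof -
    define r where "r = sqrt (real N)"
    have r: "0 < r" using N by (simp add: r_def)
    have "\<bar>x\<bar> * r \<le> r * r + x\<^sup>2"
    proof -
      have "(\<bar>x\<bar> - r)\<^sup>2 = x\<^sup>2 - 2 * (\<bar>x\<bar> * r) + r * r"
        by (simp add: power2_eq_square algebra_simps)
      moreover have "0 \<le> \<bar>x\<bar> * r"
        using r by simp
      ultimately show ?thesis
        using zero_le_power2[of "\<bar>x\<bar> - r"] by linarith
    qed
    then show ?thesis
      using r unfolding r_def[symmetric] by (simp add: field_simps power2_eq_square)
  qed
  ultimately have "\<bar>(R - x) - sqrt (R * (R + 1))\<bar> \<le> 1 + sqrt (real N) + x\<^sup>2 / sqrt (real N)"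
    by linarith
  then have "a * \<bar>(R - x) - sqrt (R * (R + 1))\<bar> \<le> a * (1 + sqrt (real N) + x\<^sup>2 / sqrt (real N))"
    using a by (rule mult_left_mono)
  moreover have "\<bar>residual N \<omega> - sqrt \<bar>final_gap N \<omega>\<bar>\<bar> = a * \<bar>(R - x) - sqrt (R * (R + 1))\<bar>"
    unfolding residual gap using a by (simp add: abs_mult flip: right_diff_distrib)
  ultimately show ?case
    unfolding a_def x_def by linarith
qed

text \<open>Both variables live on the same space and \<open>iexp\<close> is 1-Lipschitz, so the
  mean distance bounds the difference; it is of order N^(1/4 - 1 + 1/2) = N^(-1/4).\<close>

lemma residual_char_diff:
  assumes N: "1 \<le> N" and pos: "0 < X0 N" "0 < Y0 N"
  shows "cmod ((\<integral>\<omega>. iexp (t * residual N \<omega>) \<partial>M) - (\<integral>\<omega>. iexp (t * sqrt \<bar>final_gap N \<omega>\<bar>) \<partial>M))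
    \<le> \<bar>t\<bar> * (real N powr (1/4) / real N * (1 + sqrt (real N) * (1 + T)))"
proof -
  define l where "l \<omega> = X0 N + Y0 N - survivors (start N) (\<lambda>i. U i \<omega>)" for \<omega>
  define x where "x \<omega> = ((\<Sum>i<l \<omega>. E i \<omega>) - real (l \<omega>))\<^sup>2" for \<omega>
  define a where "a = real N powr (1/4) / real N"
  have x: "integrable M x" "expectation x \<le> T * real N"
    using centred_ruin_clock_moment[of "start N"] total_eq[OF N]
    by (simp_all add: x_def[abs_def] l_def)
  have [measurable]: "final_gap N \<in> borel_measurable M"
    by measurable
  have int: "integrable M (\<lambda>\<omega>. iexp (f \<omega>))" if [measurable]: "f \<in> borel_measurable M" for f
    by (rule integrable_const_bound[of _ 1]) auto
  have int_residual: "integrable M (\<lambda>\<omega>. iexp (t * residual N \<omega>))"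
    by (intro int borel_measurable_times borel_measurable_const measurable_residual)
  have int_gap: "integrable M (\<lambda>\<omega>. iexp (t * sqrt \<bar>final_gap N \<omega>\<bar>))"
    by (rule int) measurable
  have diff: "(\<integral>\<omega>. iexp (t * residual N \<omega>) \<partial>M) - (\<integral>\<omega>. iexp (t * sqrt \<bar>final_gap N \<omega>\<bar>) \<partial>M)
      = (\<integral>\<omega>. iexp (t * residual N \<omega>) - iexp (t * sqrt \<bar>final_gap N \<omega>\<bar>) \<partial>M)"
    by (rule Bochner_Integration.integral_diff[OF int_residual int_gap, symmetric])
  have "cmod ((\<integral>\<omega>. iexp (t * residual N \<omega>) \<partial>M) - (\<integral>\<omega>. iexp (t * sqrt \<bar>final_gap N \<omega>\<bar>) \<partial>M))
      \<le> (\<integral>\<omega>. cmod (iexp (t * residual N \<omega>) - iexp (t * sqrt \<bar>final_gap N \<omega>\<bar>)) \<partial>M)"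
    unfolding diff by (rule integral_norm_bound)
  also have "\<dots> \<le> (\<integral>\<omega>. \<bar>t\<bar> * (a * (1 + sqrt (real N) + x \<omega> / sqrt (real N))) \<partial>M)"
  proof (rule integral_mono_AE)
    show "integrable M (\<lambda>\<omega>. cmod (iexp (t * residual N \<omega>) - iexp (t * sqrt \<bar>final_gap N \<omega>\<bar>)))"
      by (rule integrable_norm[OF Bochner_Integration.integrable_diff[OF int_residual int_gap]])
    show "integrable M (\<lambda>\<omega>. \<bar>t\<bar> * (a * (1 + sqrt (real N) + x \<omega> / sqrt (real N))))"
      using x by simp
    show "AE \<omega> in M. cmod (iexp (t * residual N \<omega>) - iexp (t * sqrt \<bar>final_gap N \<omega>\<bar>))
        \<le> \<bar>t\<bar> * (a * (1 + sqrt (real N) + x \<omega> / sqrt (real N)))"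
      using residual_approx[OF N pos]
    proof eventually_elim
      case (elim \<omega>)
      have "cmod (iexp (t * residual N \<omega>) - iexp (t * sqrt \<bar>final_gap N \<omega>\<bar>))
          \<le> \<bar>t * residual N \<omega> - t * sqrt \<bar>final_gap N \<omega>\<bar>\<bar>"
        by (rule cmod_iexp_diff_le)
      also have "\<dots> = \<bar>t\<bar> * \<bar>residual N \<omega> - sqrt \<bar>final_gap N \<omega>\<bar>\<bar>"
        by (simp only: abs_mult right_diff_distrib[symmetric])
      also have "\<dots> \<le> \<bar>t\<bar> * (a * (1 + sqrt (real N) + x \<omega> / sqrt (real N)))"
        using elim by (intro mult_left_mono) (simp_all add: a_def x_def l_def)
      finally show ?case .
    qed
  qed
  also have "\<dots> = \<bar>t\<bar> * (a * (1 + sqrt (real N) + expectation x / sqrt (real N)))"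
    using x by (simp add: prob_space)
  also have "\<dots> \<le> \<bar>t\<bar> * (a * (1 + sqrt (real N) + T * real N / sqrt (real N)))"
    using x(2) by (intro mult_left_mono add_left_mono divide_right_mono) (auto simp: a_def)
  also have "T * real N / sqrt (real N) = T * sqrt (real N)"
    by (simp only: times_divide_eq_right[symmetric] real_div_sqrt of_nat_0_le_iff)
  finally show ?thesis
    by (simp add: a_def algebra_simps)
qed

text \<open>The weak limit of the final gap is tested against the bounded continuous function w ->
  \<open>iexp (t * sqrt \<bar>w\<bar>)\<close>, which yields the characteristic function of the
  limit law; the coupling error vanishes.\<close>

lemma residual_tendsto:
  assumes pos: "eventually (\<lambda>N. 0 < X0 N \<and> 0 < Y0 N) sequentially"
  shows "weak_conv_m (\<lambda>N. distr M borel (residual N)) (limit_law (sqrt (T ^ 3 / 3)) (T * z0))"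
proof (rule levy_continuity)
  let ?L = "distr std_normal_distribution borel (\<lambda>z. sqrt (T ^ 3 / 3) * z + T * z0)"
  have [measurable]: "final_gap N \<in> borel_measurable M" for N
    by measurable
  show "real_distribution (distr M borel (residual N))" for N
    by (rule real_distribution_distr[OF measurable_residual])
  show "real_distribution (limit_law (sqrt (T ^ 3 / 3)) (T * z0))"
    by (rule real_distribution_limit_law)
  fix t
  have "(\<lambda>N. integral\<^sup>L (distr M borel (final_gap N)) (\<lambda>w. iexp (t * sqrt \<bar>w\<bar>)))
      \<longlonglongrightarrow> integral\<^sup>L ?L (\<lambda>w. iexp (t * sqrt \<bar>w\<bar>))"
  proof (rule weak_conv_imp_integral_bdd_continuous_conv[where B=1])
    show "real_distribution (distr M borel (final_gap N))" for N
      by (rule real_distribution_distr) simp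
    show "real_distribution ?L"
      using prob_space.real_distribution_distr[OF prob_space_normal_density[of 1 0]] by simp
    show "weak_conv_m (\<lambda>N. distr M borel (final_gap N)) ?L"
      by (rule final_gap_tendsto)
    show "isCont (\<lambda>w. iexp (t * sqrt \<bar>w\<bar>)) w" for w
      by (intro continuous_intros)
  qed simp
  moreover have "integral\<^sup>L (distr M borel (final_gap N)) (\<lambda>w. iexp (t * sqrt \<bar>w\<bar>))
      = (\<integral>\<omega>. iexp (t * sqrt \<bar>final_gap N \<omega>\<bar>) \<partial>M)" for N
    by (subst integral_distr) auto
  moreover have "integral\<^sup>L ?L (\<lambda>w. iexp (t * sqrt \<bar>w\<bar>)) = char (limit_law (sqrt (T ^ 3 / 3)) (T * z0)) t"
    unfolding char_def limit_law_def by (subst (1 2) integral_distr) auto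
  ultimately have lim: "(\<lambda>N. \<integral>\<omega>. iexp (t * sqrt \<bar>final_gap N \<omega>\<bar>) \<partial>M) \<longlonglongrightarrow> char (limit_law (sqrt (T ^ 3 / 3)) (T * z0)) t"
    by simp
  have "eventually (\<lambda>N. cmod ((\<integral>\<omega>. iexp (t * residual N \<omega>) \<partial>M) - (\<integral>\<omega>. iexp (t * sqrt \<bar>final_gap N \<omega>\<bar>) \<partial>M))
      \<le> \<bar>t\<bar> * (real N powr (1/4) / real N * (1 + sqrt (real N) * (1 + T)))) sequentially"
    using pos eventually_ge_at_top[of 1] by eventually_elim (intro residual_char_diff, auto)
  moreover have "(\<lambda>N. \<bar>t\<bar> * (real N powr (1/4) / real N * (1 + sqrt (real N) * (1 + T)))) \<longlonglongrightarrow> 0"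
    by (rule tendsto_mult_right_zero) real_asymp
  ultimately have "(\<lambda>N. (\<integral>\<omega>. iexp (t * residual N \<omega>) \<partial>M) - (\<integral>\<omega>. iexp (t * sqrt \<bar>final_gap N \<omega>\<bar>) \<partial>M)) \<longlonglongrightarrow> 0"
    by (rule Lim_null_comparison)
  from tendsto_add[OF this lim]
  have "(\<lambda>N. \<integral>\<omega>. iexp (t * residual N \<omega>) \<partial>M) \<longlonglongrightarrow> char (limit_law (sqrt (T ^ 3 / 3)) (T * z0)) t"
    by simp
  moreover have "char (distr M borel (residual N)) t = (\<integral>\<omega>. iexp (t * residual N \<omega>) \<partial>M)" for N
    unfolding char_def by (rule integral_distr[OF measurable_residual]) simp
  ultimately show "(\<lambda>N. char (distr M borel (residual N)) t) \<longlonglongrightarrow> char (limit_law (sqrt (T ^ 3 / 3)) (T * z0)) t"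
    by simp
qed

end

theorem mainTheorem10:
  fixes M :: "'a measure"
    and E U :: "nat \<Rightarrow> 'a \<Rightarrow> real"
    and X0 Y0 :: "nat \<Rightarrow> nat"
    and x0 T z0 :: real
  assumes "prob_space M"
    and "prob_space.indep_vars M (\<lambda>_. borel)
           (\<lambda>i. case i of Inl k \<Rightarrow> E k | Inr k \<Rightarrow> U k) UNIV"
    and "\<And>k. distributed M lborel (E k) (\<lambda>x. ennreal (exponential_density 1 x))"
    and "\<And>k. distributed M lborel (U k) (\<lambda>x. ennreal (indicator {0..1} x))"
    and "0 < x0"
    and "(\<lambda>N. real (X0 N) / real N) \<longlonglongrightarrow> x0"
    and "(\<lambda>N. real (Y0 N) / real N) \<longlonglongrightarrow> x0"
    and "T = 2 * x0"
    and "\<And>N. 1 \<le> N \<Longrightarrow> real (X0 N) / real N + real (Y0 N) / real N = T"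
    and "(\<lambda>N. sqrt (real N) * (real (X0 N) / real N - real (Y0 N) / real N)) \<longlonglongrightarrow> z0"
  shows "\<exists>\<mu> :: real measure.
     real_distribution \<mu> \<and>
     weak_conv_m
       (\<lambda>N. distr M borel
          (\<lambda>\<omega>. real N powr (1/4) *
                 (T - ruin_time N (X0 N, Y0 N) (\<lambda>i. E i \<omega>) (\<lambda>i. U i \<omega>)))) \<mu> \<and>
     measure \<mu> {0<..} = 1 \<and>
     (\<forall>q>0. integrable \<mu> (\<lambda>s. s powr q) \<and>
        (\<integral>s. s powr q \<partial>\<mu>) =
          (2/3) powr (q/4) * (Gamma (1/2 + q/4) / Gamma (1/2)) * T powr (3*q/4)
          * hfun (3*q/4) (z0^2 / (2*T))) \<and>
     (\<forall>\<nu> :: real measure. real_distribution \<nu> \<and> measure \<nu> {0<..} = 1 \<and>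
        (\<forall>q>0. integrable \<nu> (\<lambda>s. s powr q) \<and>
           (\<integral>s. s powr q \<partial>\<nu>) = (\<integral>s. s powr q \<partial>\<mu>)) \<longrightarrow> \<nu> = \<mu>)"
proof -
  have T: "0 < T"
    using assms by simp
  interpret driven_chain M E U
    using assms(1-4) by (intro driven_chain.intro driven_chain_axioms.intro)
  interpret balanced_start M E U X0 Y0 T z0
    using T assms(9,10) by unfold_locales
  define \<mu> where "\<mu> = limit_law (sqrt (T ^ 3 / 3)) (T * z0)"
  have \<mu>: "real_distribution \<mu>" "measure \<mu> {0<..} = 1"
    unfolding \<mu>_def using T by (auto intro: real_distribution_limit_law limit_law_positive)
  have moments: "has_bochner_integral \<mu> (\<lambda>s. s powr q)
      ((2/3) powr (q/4) * (Gamma (1/2 + q/4) / Gamma (1/2)) * T powr (3*q/4) * hfun (3*q/4) (z0\<^sup>2 / (2*T)))"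
    if "0 < q" for q
    unfolding \<mu>_def by (rule limit_law_moment[OF T that])
  \<comment> \<open>For small N one side may start empty; x_0 > 0 rules this out eventually.\<close>
  have "eventually (\<lambda>N. 0 < X0 N \<and> 0 < Y0 N) sequentially"
    using order_tendstoD(1)[OF assms(6,5)] order_tendstoD(1)[OF assms(7,5)]
    by eventually_elim (auto intro: gr0I)
  then have conv: "weak_conv_m (\<lambda>N. distr M borel (residual N)) \<mu>"
    unfolding \<mu>_def by (rule residual_tendsto)
  have unique: "\<nu> = \<mu>" if "real_distribution \<nu>" "measure \<nu> {0<..} = 1"
    and same: "\<forall>q>0. integrable \<nu> (\<lambda>s. s powr q) \<and> (\<integral>s. s powr q \<partial>\<nu>) = (\<integral>s. s powr q \<partial>\<mu>)" for \<nu>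
  proof (rule real_distribution_eqI_powr_moments)
    show "integrable \<mu> (\<lambda>s. s powr q)" if "0 < q" for q
      using moments[OF that] by (simp add: has_bochner_integral_iff)
    show "integrable \<mu> (\<lambda>s. exp (a * s\<^sup>2))" for a
      unfolding \<mu>_def by (rule limit_law_exp_integrable)
    show "integrable \<nu> (\<lambda>s. s powr q)" "(\<integral>s. s powr q \<partial>\<nu>) = (\<integral>s. s powr q \<partial>\<mu>)" if "0 < q" for q
      using same that by blast+
  qed (fact \<mu> that)+
  show ?thesis
  proof (intro exI[of _ \<mu>] conjI allI impI)
    fix q :: real
    assume "0 < q"
    note m = moments[OF this, unfolded has_bochner_integral_iff]
    show "integrable \<mu> (\<lambda>s. s powr q)"
      by (rule conjunct1[OF m])
    show "(\<integral>s. s powr q \<partial>\<mu>) =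
          (2/3) powr (q/4) * (Gamma (1/2 + q/4) / Gamma (1/2)) * T powr (3*q/4)
          * hfun (3*q/4) (z0^2 / (2*T))"
      by (rule conjunct2[OF m])
  next
    fix \<nu> :: "real measure"
    assume "real_distribution \<nu> \<and> measure \<nu> {0<..} = 1 \<and>
        (\<forall>q>0. integrable \<nu> (\<lambda>s. s powr q) \<and> (\<integral>s. s powr q \<partial>\<nu>) = (\<integral>s. s powr q \<partial>\<mu>))"
    then show "\<nu> = \<mu>"
      by (elim conjE) (rule unique)
  qed (fact \<mu> conv)+
qed

end
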